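(* Let $\omega\ne0$ and suppose that $\beta$ is real analytic. Let $(\theta_0,\rho_0)$ be an admissible initial datum with $\rho_0\equiv\nu$. There exists $\mu_0\in(0,\infty)$ such that if $\mu\ge\mu_0$, then the limit $(\theta_\infty,\rho_\infty)=\lim_{t\to\infty}(\theta(t),\rho(t))$ (in $C^2([0,L])$) of the solution $(\theta,\rho)$ of the flow (F) with parameter $\mu$ and initial datum $(\theta_0,\rho_0)$ describes an $\omega$-fold covered circle with constant density, that is, $\partial_s\theta_\infty\equiv\frac{2\pi\omega}{L}$ and $\rho_\infty\equiv\nu$.
   Context: Parameters: $L>0$, $\nu\in\mathbb{R}$, $\omega\in\mathbb{Z}$, $c_0\in\mathbb{R}$ and $\beta\in C^\infty(\mathbb{R})$ with $\beta>0$ are fixed; $\mu>0$ is a further parameter. The notion of admissible initial datum below does not depend on $\mu$. A function $\theta:[0,L]\to\mathbb{R}$ is the inclination angle of the arc-length parametrized planar curve $\gamma(s)=\gamma(0)+\int_0^s(\cos\theta,\sin\theta)\,\mathrm{d}r$, with curvature $\kappa=\partial_s\theta$; $\rho:[0,L]\to\mathbb{R}$ is a density. The flow (F) is the initial boundary value problem $$\partial_t\theta=\partial_s\big(\beta(\rho)(\partial_s\theta-c_0)\big)+\lambda_{\theta1}\sin\theta-\lambda_{\theta2}\cos\theta,\qquad \partial_t\rho=\mu\,\partial_s^2\rho-\tfrac12\beta'(\rho)(\partial_s\theta-c_0)^2-\lambda_\rho$$ on $(0,T)\times[0,L]$, with boundary conditions $\theta(\cdot,L)-\theta(\cdot,0)=2\pi\omega$,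 $\rho(\cdot,L)=\rho(\cdot,0)$, $\partial_s\theta(\cdot,L)=\partial_s\theta(\cdot,0)$, $\partial_s\rho(\cdot,L)=\partial_s\rho(\cdot,0)$, and initial condition $(\theta,\rho)(0,\cdot)=(\theta_0,\rho_0)$. The nonlocal multipliers are $$\begin{pmatrix}\lambda_{\theta1}\\ \lambda_{\theta2}\end{pmatrix}(t)=\Pi^{-1}(\theta)\int_0^L\begin{pmatrix}\cos\theta\\ \sin\theta\end{pmatrix}\partial_s\theta\,\beta(\rho)(\partial_s\theta-c_0)\,\mathrm{d}s,\quad \Pi(\theta)=\begin{pmatrix}\int_0^L\sin^2\theta\,\mathrm{d}s&-\int_0^L\cos\theta\sin\theta\,\mathrm{d}s\\-\int_0^L\cos\theta\sin\theta\,\mathrm{d}s&\int_0^L\cos^2\theta\,\mathrm{d}s\end{pmatrix},$$ $\lambda_\rho(t)=-\frac1{2L}\int_0^L\beta'(\rho)(\partial_s\theta-c_0)^2\,\mathrm{d}s$. An admissible initial datum is $(\theta_0,\rho_0)\in C^\infty([0,L])$ with $\int_0^L\rho_0\,\mathrm{d}s=\nu L$, $\int_0^L\sin\theta_0\,\mathrm{d}s=\int_0^L\cos\theta_0\,\mathrm{d}s=0$, $\theta_0(L)-\theta_0(0)=2\pi\omega$, $\rho_0(L)=\rho_0(0)$, and $\partial_s^j\theta_0(L)=\partial_s^j\theta_0(0)$, $\partial_s^j\rho_0(L)=\partial_s^j\rho_0(0)$ for $j=1,2$. By earlier work, for each admissible initial datum (F) has a unique global solution $(\theta,\rho)\in C^\infty((0,\infty)\times[0,L])\cap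 C^0([0,\infty);C^2([0,L]))$; if $\beta$ is real analytic, this solution converges in $C^2([0,L])$ as $t\to\infty$ to some stationary solution $(\theta_\infty,\rho_\infty)$ of (F). *)

theory Defs
  imports "HOL-Analysis.Analysis"
begin

text \<open>
  A function on \<open>[0,L]\<close> is a total function \<open>real \<Rightarrow> real\<close> of which only the values on \<open>{0..L}\<close>
  matter. Accordingly, derivatives in \<open>s\<close> are taken within \<open>{0..L}\<close>, so that they are one-sided
  at the two end points.
\<close>

definition ds :: "real \<Rightarrow> (real \<Rightarrow> real) \<Rightarrow> real \<Rightarrow> real" where
  "ds L f s = vector_derivative f (at s within {0..L})"

definition smooth_on_R :: "(real \<Rightarrow> real) \<Rightarrow> bool" where
  "smooth_on_R f \<longleftrightarrow> (\<forall>n x. (deriv ^^ n) f differentiable (at x))"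

definition real_analytic :: "(real \<Rightarrow> real) \<Rightarrow> bool" where
  "real_analytic f \<longleftrightarrow> (\<forall>x. \<exists>F. (\<lambda>h. f (x + h)) has_fps_expansion F)"

definition smooth_on_interval :: "real \<Rightarrow> (real \<Rightarrow> real) \<Rightarrow> bool" where
  "smooth_on_interval L f \<longleftrightarrow>
     (\<forall>n. \<forall>s\<in>{0..L}. (ds L ^^ n) f differentiable (at s within {0..L}))"

definition C2_on_interval :: "real \<Rightarrow> (real \<Rightarrow> real) \<Rightarrow> bool" where
  "C2_on_interval L f \<longleftrightarrow>
     (\<forall>k<2. \<forall>s\<in>{0..L}. (ds L ^^ k) f differentiable (at s within {0..L})) \<and>
     (\<forall>k\<le>2. continuous_on {0..L} ((ds L ^^ k) f))"

definition C2_tendsto :: "real \<Rightarrow> ('t \<Rightarrow> real \<Rightarrow> real) \<Rightarrow> (real \<Rightarrow> real) \<Rightarrow> 't filter \<Rightarrow> bool" where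
  "C2_tendsto L u g F \<longleftrightarrow>
     (\<forall>\<^sub>F t in F. C2_on_interval L (u t)) \<and> C2_on_interval L g \<and>
     (\<forall>k\<le>2. uniform_limit {0..L} (\<lambda>t. (ds L ^^ k) (u t)) ((ds L ^^ k) g) F)"

text \<open>A function of time \<open>t\<close> and arc length \<open>s\<close> is written \<open>u t s\<close>.\<close>

definition dt :: "(real \<Rightarrow> real \<Rightarrow> real) \<Rightarrow> real \<Rightarrow> real \<Rightarrow> real" where
  "dt u t s = vector_derivative (\<lambda>\<tau>. u \<tau> s) (at t)"

fun Ck_spacetime :: "nat \<Rightarrow> real \<Rightarrow> (real \<Rightarrow> real \<Rightarrow> real) \<Rightarrow> bool" where
  "Ck_spacetime 0 L u \<longleftrightarrow> continuous_on ({0<..} \<times> {0..L}) (\<lambda>(t, s). u t s)"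
| "Ck_spacetime (Suc k) L u \<longleftrightarrow>
     (\<forall>t>0. \<forall>s\<in>{0..L}. (\<lambda>\<tau>. u \<tau> s) differentiable (at t) \<and>
                         u t differentiable (at s within {0..L})) \<and>
     Ck_spacetime k L (dt u) \<and> Ck_spacetime k L (\<lambda>t. ds L (u t))"

text \<open>\<open>C\<^sup>\<infinity>((0,\<infinity>) \<times> [0,L])\<close>, with all derivatives continuous up to the end points of \<open>[0,L]\<close>.\<close>

definition smooth_spacetime :: "real \<Rightarrow> (real \<Rightarrow> real \<Rightarrow> real) \<Rightarrow> bool" where
  "smooth_spacetime L u \<longleftrightarrow> (\<forall>k. Ck_spacetime k L u)"

text \<open>\<open>C\<^sup>0([0,\<infinity>); C\<^sup>2([0,L]))\<close>\<close>

definition continuous_into_C2 :: "real \<Rightarrow> (real \<Rightarrow> real \<Rightarrow> real) \<Rightarrow> bool" where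
  "continuous_into_C2 L u \<longleftrightarrow>
     (\<forall>t\<ge>0. C2_on_interval L (u t) \<and> C2_tendsto L u (u t) (at t within {0..}))"

definition Pi_matrix :: "real \<Rightarrow> (real \<Rightarrow> real) \<Rightarrow> real^2^2" where
  "Pi_matrix L \<theta> = vector
     [vector [integral {0..L} (\<lambda>s. (sin (\<theta> s))\<^sup>2), - integral {0..L} (\<lambda>s. cos (\<theta> s) * sin (\<theta> s))],
      vector [- integral {0..L} (\<lambda>s. cos (\<theta> s) * sin (\<theta> s)), integral {0..L} (\<lambda>s. (cos (\<theta> s))\<^sup>2)]]"

definition lambda_theta ::
  "real \<Rightarrow> real \<Rightarrow> (real \<Rightarrow> real) \<Rightarrow> (real \<Rightarrow> real) \<Rightarrow> (real \<Rightarrow> real) \<Rightarrow> real^2" where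
  "lambda_theta L c0 \<beta> \<theta> \<rho> = matrix_inv (Pi_matrix L \<theta>) *v vector
     [integral {0..L} (\<lambda>s. cos (\<theta> s) * ds L \<theta> s * \<beta> (\<rho> s) * (ds L \<theta> s - c0)),
      integral {0..L} (\<lambda>s. sin (\<theta> s) * ds L \<theta> s * \<beta> (\<rho> s) * (ds L \<theta> s - c0))]"

definition lambda_rho ::
  "real \<Rightarrow> real \<Rightarrow> (real \<Rightarrow> real) \<Rightarrow> (real \<Rightarrow> real) \<Rightarrow> (real \<Rightarrow> real) \<Rightarrow> real" where
  "lambda_rho L c0 \<beta> \<theta> \<rho> =
     - (1 / (2 * L)) * integral {0..L} (\<lambda>s. deriv \<beta> (\<rho> s) * (ds L \<theta> s - c0)\<^sup>2)"

definition admissible_datum ::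
  "real \<Rightarrow> real \<Rightarrow> int \<Rightarrow> (real \<Rightarrow> real) \<Rightarrow> (real \<Rightarrow> real) \<Rightarrow> bool" where
  "admissible_datum L \<nu> \<omega> \<theta>0 \<rho>0 \<longleftrightarrow>
     smooth_on_interval L \<theta>0 \<and> smooth_on_interval L \<rho>0 \<and>
     integral {0..L} \<rho>0 = \<nu> * L \<and>
     integral {0..L} (\<lambda>s. sin (\<theta>0 s)) = 0 \<and> integral {0..L} (\<lambda>s. cos (\<theta>0 s)) = 0 \<and>
     \<theta>0 L - \<theta>0 0 = 2 * pi * of_int \<omega> \<and> \<rho>0 L = \<rho>0 0 \<and>
     (\<forall>j\<in>{1, 2}. (ds L ^^ j) \<theta>0 L = (ds L ^^ j) \<theta>0 0 \<and> (ds L ^^ j) \<rho>0 L = (ds L ^^ j) \<rho>0 0)"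

text \<open>
  Global solutions of the flow, in the regularity class in which existence and uniqueness hold.
\<close>

definition flow_solution ::
  "real \<Rightarrow> int \<Rightarrow> real \<Rightarrow> (real \<Rightarrow> real) \<Rightarrow> real \<Rightarrow> (real \<Rightarrow> real) \<Rightarrow> (real \<Rightarrow> real) \<Rightarrow>
   (real \<Rightarrow> real \<Rightarrow> real) \<Rightarrow> (real \<Rightarrow> real \<Rightarrow> real) \<Rightarrow> bool" where
  "flow_solution L \<omega> c0 \<beta> \<mu> \<theta>0 \<rho>0 \<theta> \<rho> \<longleftrightarrow>
     smooth_spacetime L \<theta> \<and> smooth_spacetime L \<rho> \<and>
     continuous_into_C2 L \<theta> \<and> continuous_into_C2 L \<rho> \<and>
     (\<forall>t>0. \<forall>s\<in>{0..L}.
        dt \<theta> t s = ds L (\<lambda>r. \<beta> (\<rho> t r) * (ds L (\<theta> t) r - c0)) s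
                   + lambda_theta L c0 \<beta> (\<theta> t) (\<rho> t) $ 1 * sin (\<theta> t s)
                   - lambda_theta L c0 \<beta> (\<theta> t) (\<rho> t) $ 2 * cos (\<theta> t s) \<and>
        dt \<rho> t s = \<mu> * ds L (ds L (\<rho> t)) s
                   - 1 / 2 * deriv \<beta> (\<rho> t s) * (ds L (\<theta> t) s - c0)\<^sup>2
                   - lambda_rho L c0 \<beta> (\<theta> t) (\<rho> t)) \<and>
     (\<forall>t>0. \<theta> t L - \<theta> t 0 = 2 * pi * of_int \<omega> \<and> \<rho> t L = \<rho> t 0 \<and>
             ds L (\<theta> t) L = ds L (\<theta> t) 0 \<and> ds L (\<rho> t) L = ds L (\<rho> t) 0) \<and>
     (\<forall>s\<in>{0..L}. \<theta> 0 s = \<theta>0 s \<and> \<rho> 0 s = \<rho>0 s)"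

end

theory Submission
  imports Defs
begin

text \<open>
  The energy \<open>\<integral> \<beta>(\<rho>) (\<kappa> - c0)\<^sup>2 / 2 + \<mu> \<rho>'\<^sup>2 / 2\<close>, \<open>\<kappa> = \<theta>'\<close>, decreases along the flow, while the closing
  condition and the mass are preserved. Since \<open>\<rho>0\<close> is constant, the initial energy does not depend on
  \<open>\<mu>\<close>; hence the limit is a stationary solution with \<open>\<rho>\<close> close to \<open>\<nu>\<close> for large \<open>\<mu>\<close> and with bounds on
  \<open>\<kappa>\<close> and on the multiplier that are uniform in \<open>\<mu>\<close>. Such a stationary solution is an almost exact
  pendulum that winds around, so \<open>\<kappa>\<^sup>2\<close> is bounded below by a positive constant. Integrating
  \<open>(sin \<theta> / \<kappa>)'\<close> over the closed curve then bounds the multiplier, and with it \<open>\<kappa>'\<close>, by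
  \<open>r = max \<bar>\<rho>'\<bar>\<close>. The density equation turns this into \<open>r \<le> const r / \<mu>\<close>, so that \<open>r = 0\<close> for
  large \<open>\<mu>\<close> and \<open>\<kappa>\<close> is constant.
\<close>

section \<open>One-variable calculus on an interval\<close>

text \<open>The exact case \<open>\<sigma> = 0\<close> shows the mechanism. There
  \<open>\<kappa>' = - lam sin \<theta> / \<beta>\<close>, so \<open>(sin \<theta> / \<kappa>)' =
  cos \<theta> + lam sin^2 \<theta> / (\<beta> \<kappa>^2)\<close>; for a closed curve the integral
  of the last term vanishes, and \<open>lam = 0\<close>. The winding number enters twice: it keeps
  the integral of \<open>sin^2 \<theta>\<close> away from zero and keeps \<open>\<kappa>\<close>
  from vanishing. The obstacle is uniformity. All constants must be fixed before \<mu>, the profile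
  and its multipliers are known, while \<beta> and its derivatives are controlled only on compact
  sets. The energy confines \<rho> to \<open>[\<nu> - 1, \<nu> + 1]\<close>. On that range
  \<open>lam\<close> and \<kappa> can be bounded without any bound on the slope of \<rho>, because
  the angle equation is \<open>w' = - lam sin \<theta>\<close> for the moment
  \<open>w = \<beta>(\<rho>) (\<kappa> - c0)\<close>. The density equation is then used twice:
  crudely, to make the slope of order \<open>1 / \<mu>\<close> and so legitimize the division by
  \<kappa>, and once more with an estimate that is linear in the slope, which forces the slope to
  vanish.\<close>

lemma has_integral_real_derivative:
  fixes f :: "real \<Rightarrow> real"
  assumes "a \<le> b" "\<And>s. s \<in> {a..b} \<Longrightarrow> (f has_real_derivative f' s) (at s within {a..b})"
  shows "(f' has_integral f b - f a) {a..b}"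
  using assms
  by (intro fundamental_theorem_of_calculus) (auto simp: has_real_derivative_iff_has_vector_derivative)

lemma mean_value_Icc:
  fixes f :: "real \<Rightarrow> real"
  assumes "a \<le> b" "\<And>s. s \<in> {a..b} \<Longrightarrow> (f has_real_derivative f' s) (at s within {a..b})"
  obtains s where "s \<in> {a..b}" "f b - f a = f' s * (b - a)"
  using mvt_very_simple[of a b f "\<lambda>s h. f' s * h"] assms
  by (auto simp: has_field_derivative_def)

lemma derivative_bound_Icc:
  fixes f :: "real \<Rightarrow> real"
  assumes "\<And>s. s \<in> {a..b} \<Longrightarrow> (f has_real_derivative f' s) (at s within {a..b})"
    and "\<And>s. s \<in> {a..b} \<Longrightarrow> \<bar>f' s\<bar> \<le> C" and "x \<in> {a..b}" "y \<in> {a..b}"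
  shows "\<bar>f x - f y\<bar> \<le> C * (b - a)"
proof -
  have "\<bar>f x - f y\<bar> \<le> C * \<bar>x - y\<bar>"
    using field_differentiable_bound[of "{a..b}" f f' C x y] assms by auto
  also have "\<dots> \<le> C * (b - a)"
    using assms(2)[OF assms(3)] assms(3,4) by (intro mult_left_mono) auto
  finally show ?thesis .
qed

lemma nonneg_derivative_Icc_mono:
  fixes f :: "real \<Rightarrow> real"
  assumes "\<And>s. s \<in> {a..b} \<Longrightarrow> (f has_real_derivative f' s) (at s within {a..b})"
    and "\<And>s. s \<in> {a..b} \<Longrightarrow> 0 \<le> f' s" and "x \<in> {a..b}" "y \<in> {a..b}" "x \<le> y"
  shows "f x \<le> f y"
proof -
  have "(f has_real_derivative f' s) (at s within {x..y})" if "s \<in> {x..y}" for s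
    using that assms by (intro DERIV_subset[OF assms(1)]) auto
  then obtain s where "s \<in> {x..y}" "f y - f x = f' s * (y - x)"
    using mean_value_Icc[of x y f f'] assms by metis
  moreover have "0 \<le> f' s * (y - x)"
    using assms \<open>s \<in> {x..y}\<close> by (intro mult_nonneg_nonneg) auto
  ultimately show ?thesis by simp
qed

text \<open>The hypothesis makes \<open>v exp(C s)\<close> nondecreasing and
  \<open>v exp(- C s)\<close> nonincreasing, so the estimate propagates to the right and to the
  left. Both directions matter: the point at which the angle equals pi may lie anywhere in the
  interval.\<close>

lemma Gronwall_Icc:
  fixes v :: "real \<Rightarrow> real"
  assumes v: "\<And>s. s \<in> {a..b} \<Longrightarrow> (v has_real_derivative v' s) (at s within {a..b})"
    and bound: "\<And>s. s \<in> {a..b} \<Longrightarrow> \<bar>v' s\<bar> \<le> C * v s"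
    and "0 \<le> C" "\<And>s. s \<in> {a..b} \<Longrightarrow> 0 \<le> v s" and xy: "x \<in> {a..b}" "y \<in> {a..b}"
  shows "v x \<le> v y * exp (C * (b - a))"
proof -
  have "v x \<le> v y * exp (C * \<bar>x - y\<bar>)"
  proof (cases "x \<le> y")
    case True
    have "v x * exp (C * x) \<le> v y * exp (C * y)"
    proof (rule nonneg_derivative_Icc_mono[where f = "\<lambda>s. v s * exp (C * s)" and f' = "\<lambda>s. (v' s + C * v s) * exp (C * s)"])
      show "((\<lambda>s. v s * exp (C * s)) has_real_derivative (v' s + C * v s) * exp (C * s)) (at s within {a..b})"
        if "s \<in> {a..b}" for s
        by (rule derivative_eq_intros v[OF that] refl)+ (simp add: algebra_simps)
      show "0 \<le> (v' s + C * v s) * exp (C * s)" if "s \<in> {a..b}" for s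
        using bound[OF that] by (intro mult_nonneg_nonneg) auto
    qed (use True xy in auto)
    then have "v x * exp (C * x) * exp (- C * x) \<le> v y * exp (C * y) * exp (- C * x)"
      by (intro mult_right_mono) auto
    then show ?thesis using True by (simp add: mult.assoc exp_add[symmetric] algebra_simps)
  next
    case False
    have "- (v y * exp (- C * y)) \<le> - (v x * exp (- C * x))"
    proof (rule nonneg_derivative_Icc_mono[where f = "\<lambda>s. - (v s * exp (- C * s))" and f' = "\<lambda>s. (C * v s - v' s) * exp (- C * s)"])
      show "((\<lambda>s. - (v s * exp (- C * s))) has_real_derivative (C * v s - v' s) * exp (- C * s)) (at s within {a..b})"
        if "s \<in> {a..b}" for s
        by (rule derivative_eq_intros v[OF that] refl)+ (simp add: algebra_simps)
      show "0 \<le> (C * v s - v' s) * exp (- C * s)" if "s \<in> {a..b}" for s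
        using bound[OF that] by (intro mult_nonneg_nonneg) auto
    qed (use False xy in auto)
    then have "v x * exp (- C * x) * exp (C * x) \<le> v y * exp (- C * y) * exp (C * x)"
      by (intro mult_right_mono) auto
    then show ?thesis using False by (simp add: mult.assoc exp_add[symmetric] algebra_simps)
  qed
  also have "\<dots> \<le> v y * exp (C * (b - a))"
    using assms(3,4) xy by (intro mult_left_mono iffD2[OF exp_le_cancel_iff] ) auto
  finally show ?thesis .
qed

text \<open>Expanding the integral of \<open>(G f - P g)^2 \<ge> 0\<close> gives
  \<open>0 \<le> G (F G - P^2)\<close>. If \<open>G = 0\<close>, continuity forces
  \<open>g = 0\<close> and both sides vanish.\<close>

lemma Cauchy_Schwarz_integral_Icc:
  fixes f g :: "real \<Rightarrow> real"
  assumes "a < b" and [continuous_intros]: "continuous_on {a..b} f" "continuous_on {a..b} g"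
  shows "(integral {a..b} (\<lambda>s. f s * g s))\<^sup>2 \<le> integral {a..b} (\<lambda>s. (f s)\<^sup>2) * integral {a..b} (\<lambda>s. (g s)\<^sup>2)"
proof -
  define F P G where "F = integral {a..b} (\<lambda>s. (f s)\<^sup>2)"
    and "P = integral {a..b} (\<lambda>s. f s * g s)" and "G = integral {a..b} (\<lambda>s. (g s)\<^sup>2)"
  have I: "((\<lambda>s. (f s)\<^sup>2) has_integral F) {a..b}" "((\<lambda>s. f s * g s) has_integral P) {a..b}"
    "((\<lambda>s. (g s)\<^sup>2) has_integral G) {a..b}"
    unfolding F_def P_def G_def
    by (intro integrable_integral integrable_continuous_real continuous_intros)+
  have "G \<ge> 0" unfolding G_def
    by (intro integral_nonneg integrable_continuous_real continuous_intros) auto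
  have "((\<lambda>s. G\<^sup>2 * (f s)\<^sup>2 - 2 * G * P * (f s * g s) + P\<^sup>2 * (g s)\<^sup>2) has_integral
      G\<^sup>2 * F - 2 * G * P * P + P\<^sup>2 * G) {a..b}"
    by (intro has_integral_add has_integral_diff has_integral_mult_right I)
  then have "0 \<le> G\<^sup>2 * F - 2 * G * P * P + P\<^sup>2 * G"
  proof (rule has_integral_nonneg)
    show "0 \<le> G\<^sup>2 * (f s)\<^sup>2 - 2 * G * P * (f s * g s) + P\<^sup>2 * (g s)\<^sup>2" for s
      using zero_le_power2[of "G * f s - P * g s"] by (simp add: power2_eq_square algebra_simps)
  qed
  then have *: "0 \<le> G * (F * G - P\<^sup>2)" by (simp add: power2_eq_square algebra_simps)
  show ?thesis
  proof (cases "G = 0")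
    case True
    then have "\<forall>s\<in>{a..b}. (g s)\<^sup>2 = 0"
      using integral_eq_0_iff[of a b "\<lambda>s. (g s)\<^sup>2"] assms(1) unfolding G_def
      by (auto intro!: continuous_intros)
    then have "P = integral {a..b} (\<lambda>s. 0)"
      unfolding P_def by (intro integral_cong) auto
    then show ?thesis using True unfolding F_def[symmetric] P_def[symmetric] G_def[symmetric] by simp
  next
    case False
    then show ?thesis using * \<open>G \<ge> 0\<close> unfolding F_def[symmetric] P_def[symmetric] G_def[symmetric]
      by (auto simp: zero_le_mult_iff)
  qed
qed

text \<open>The end values differ by at least a full turn, so the interval between them contains a
  representative of every direction. The ceiling \<open>k\<close> selects the one in
  \<open>[m, m + 2 pi]\<close>, above the smaller end value, and the intermediate value theorem
  applies.\<close>

lemma winding_attains_angle: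
  fixes \<theta> :: "real \<Rightarrow> real"
  assumes "0 \<le> L" "continuous_on {0..L} \<theta>" "\<theta> L - \<theta> 0 = 2 * pi * of_int \<omega>" "\<omega> \<noteq> 0"
  obtains s and k :: int where "s \<in> {0..L}" "\<theta> s = \<phi> + 2 * pi * of_int k"
proof -
  define m where "m = min (\<theta> 0) (\<theta> L)"
  define k where "k = \<lceil>(m - \<phi>) / (2 * pi)\<rceil>"
  have "1 \<le> \<bar>\<omega>\<bar>" using assms(4) by linarith
  then have "1 \<le> \<bar>real_of_int \<omega>\<bar>" by linarith
  then have "\<bar>\<theta> L - \<theta> 0\<bar> \<ge> 2 * pi"
    using mult_left_mono[of 1 "\<bar>real_of_int \<omega>\<bar>" "2 * pi"] unfolding assms(3) by (simp add: abs_mult)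
  moreover have "(m - \<phi>) / (2 * pi) \<le> real_of_int k" "real_of_int k \<le> (m - \<phi>) / (2 * pi) + 1"
    unfolding k_def by linarith+
  then have "m \<le> \<phi> + 2 * pi * real_of_int k" "\<phi> + 2 * pi * real_of_int k \<le> m + 2 * pi"
    by (auto simp: field_simps)
  ultimately have "\<theta> 0 \<le> \<phi> + 2 * pi * of_int k \<and> \<phi> + 2 * pi * of_int k \<le> \<theta> L \<or>
      \<theta> L \<le> \<phi> + 2 * pi * of_int k \<and> \<phi> + 2 * pi * of_int k \<le> \<theta> 0"
    unfolding m_def by (auto simp: min_def split: if_splits)
  then show thesis
    using IVT'[of \<theta> 0 "\<phi> + 2 * pi * of_int k" L] IVT2'[of \<theta> L "\<phi> + 2 * pi * of_int k" 0]
      assms(1,2) that by auto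
qed

section \<open>Rigidity of stationary solutions\<close>

text \<open>
  The angle is rotated such that the two multipliers become \<open>(lam, 0)\<close> with \<open>lam \<ge> 0\<close>. The unstable
  equilibrium of the pendulum is then \<open>\<theta> = \<pi>\<close>.
\<close>

locale stationary_profile =
  fixes L c0 \<mu> lam m b B B1 B2 K :: real and \<omega> :: int
    and \<beta> \<beta>1 \<beta>2 \<theta> \<kappa> \<kappa>1 \<rho> \<sigma> \<sigma>1 :: "real \<Rightarrow> real"
  assumes L_pos: "0 < L" and mu_pos: "0 < \<mu>" and lam_nonneg: "0 \<le> lam"
    and omega_nz: "\<omega> \<noteq> 0" and b_pos: "0 < b"
    and beta_deriv: "\<And>x. (\<beta> has_real_derivative \<beta>1 x) (at x)"
    and beta1_deriv: "\<And>x. (\<beta>1 has_real_derivative \<beta>2 x) (at x)"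
    and beta_bounds: "\<And>s. s \<in> {0..L} \<Longrightarrow> b \<le> \<beta> (\<rho> s)" "\<And>s. s \<in> {0..L} \<Longrightarrow> \<beta> (\<rho> s) \<le> B"
      "\<And>s. s \<in> {0..L} \<Longrightarrow> \<bar>\<beta>1 (\<rho> s)\<bar> \<le> B1" "\<And>s. s \<in> {0..L} \<Longrightarrow> \<bar>\<beta>2 (\<rho> s)\<bar> \<le> B2"
    and theta_deriv: "\<And>s. s \<in> {0..L} \<Longrightarrow> (\<theta> has_real_derivative \<kappa> s) (at s within {0..L})"
    and kappa_deriv: "\<And>s. s \<in> {0..L} \<Longrightarrow> (\<kappa> has_real_derivative \<kappa>1 s) (at s within {0..L})"
    and rho_deriv: "\<And>s. s \<in> {0..L} \<Longrightarrow> (\<rho> has_real_derivative \<sigma> s) (at s within {0..L})"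
    and sigma_deriv: "\<And>s. s \<in> {0..L} \<Longrightarrow> (\<sigma> has_real_derivative \<sigma>1 s) (at s within {0..L})"
    and elastica: "\<And>s. s \<in> {0..L} \<Longrightarrow>
      \<beta> (\<rho> s) * \<kappa>1 s + \<beta>1 (\<rho> s) * \<sigma> s * (\<kappa> s - c0) = - lam * sin (\<theta> s)"
    and density: "\<And>s. s \<in> {0..L} \<Longrightarrow> \<mu> * \<sigma>1 s = \<beta>1 (\<rho> s) * (\<kappa> s - c0)\<^sup>2 / 2 + m"
    and winding: "\<theta> L - \<theta> 0 = 2 * pi * of_int \<omega>"
    and periodic: "\<kappa> L = \<kappa> 0" "\<rho> L = \<rho> 0" "\<sigma> L = \<sigma> 0"
    and closed: "integral {0..L} (\<lambda>s. cos (\<theta> s)) = 0"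
    and bending: "integral {0..L} (\<lambda>s. (\<kappa> s)\<^sup>2) \<le> K"
begin

section \<open>Regularity of a profile and bounds that do not depend on \<mu>\<close>

lemma continuous_profile [continuous_intros]:
  "continuous_on {0..L} \<theta>" "continuous_on {0..L} \<kappa>" "continuous_on {0..L} \<rho>" "continuous_on {0..L} \<sigma>"
  using theta_deriv kappa_deriv rho_deriv sigma_deriv by (meson DERIV_continuous_on)+

lemma continuous_beta [continuous_intros]:
  "continuous_on {0..L} (\<lambda>s. \<beta> (\<rho> s))" "continuous_on {0..L} (\<lambda>s. \<beta>1 (\<rho> s))"
proof -
  have "continuous_on UNIV \<beta>" "continuous_on UNIV \<beta>1"
    using beta_deriv beta1_deriv by (meson DERIV_continuous_on)+
  then show "continuous_on {0..L} (\<lambda>s. \<beta> (\<rho> s))" "continuous_on {0..L} (\<lambda>s. \<beta>1 (\<rho> s))"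
    by (auto intro: continuous_on_compose2 continuous_profile)
qed

lemma beta_pos: "s \<in> {0..L} \<Longrightarrow> 0 < \<beta> (\<rho> s)"
  using beta_bounds(1)[of s] b_pos by linarith

lemma const_nonneg: "0 < B" "0 \<le> B1" "0 \<le> B2"
  using beta_bounds[of 0] beta_pos[of 0] L_pos by auto

lemma beta_rho_deriv: "s \<in> {0..L} \<Longrightarrow>
    ((\<lambda>s. \<beta> (\<rho> s)) has_real_derivative \<beta>1 (\<rho> s) * \<sigma> s) (at s within {0..L})"
  using DERIV_chain2[OF beta_deriv rho_deriv] .

lemma beta1_rho_deriv: "s \<in> {0..L} \<Longrightarrow>
    ((\<lambda>s. \<beta>1 (\<rho> s)) has_real_derivative \<beta>2 (\<rho> s) * \<sigma> s) (at s within {0..L})"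
  using DERIV_chain2[OF beta1_deriv rho_deriv] .

text \<open>In terms of the bending moment the angle equation contains neither \<sigma> nor the
  derivative of \<beta>. This is why the bounds on \<open>lam\<close> and \<kappa> below need no
  control of the slope of the density.\<close>

lemma moment_deriv:
  assumes "s \<in> {0..L}"
  shows "((\<lambda>s. \<beta> (\<rho> s) * (\<kappa> s - c0)) has_real_derivative - lam * sin (\<theta> s)) (at s within {0..L})"
  by (rule derivative_eq_intros beta_rho_deriv kappa_deriv assms refl)+
     (use elastica[OF assms] in \<open>simp add: algebra_simps\<close>)

lemma end_angle: "sin (\<theta> L) = sin (\<theta> 0)" "cos (\<theta> L) = cos (\<theta> 0)"
proof -
  have "\<theta> L = \<theta> 0 + 2 * pi * of_int \<omega>" using winding by simp
  then show "sin (\<theta> L) = sin (\<theta> 0)" "cos (\<theta> L) = cos (\<theta> 0)"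
    by (simp_all add: sin_add cos_add sin_int_2pin cos_int_2pin)
qed

text \<open>The integral of \<open>sin\<^sup>2 \<theta> \<kappa>\<close> only depends on the winding number.\<close>

lemma sin_square_lower: "1 \<le> K * integral {0..L} (\<lambda>s. (sin (\<theta> s))\<^sup>2)" "0 \<le> K"
proof -
  have cont: "continuous_on {0..L} (\<lambda>s. sin (\<theta> s))" "continuous_on {0..L} (\<lambda>s. sin (\<theta> s) * \<kappa> s)"
    by (intro continuous_intros)+
  have "((\<lambda>s. sin (\<theta> s) * (sin (\<theta> s) * \<kappa> s)) has_integral
      (\<theta> L - sin (\<theta> L) * cos (\<theta> L)) / 2 - (\<theta> 0 - sin (\<theta> 0) * cos (\<theta> 0)) / 2) {0..L}"
  proof (rule has_integral_real_derivative)
    fix s assume s: "s \<in> {0..L}"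
    have "(cos (\<theta> s))\<^sup>2 * \<kappa> s = (1 - (sin (\<theta> s))\<^sup>2) * \<kappa> s" by (simp add: cos_squared_eq)
    then show "((\<lambda>s. (\<theta> s - sin (\<theta> s) * cos (\<theta> s)) / 2) has_real_derivative
        sin (\<theta> s) * (sin (\<theta> s) * \<kappa> s)) (at s within {0..L})"
      by (auto intro!: derivative_eq_intros theta_deriv s simp: algebra_simps power2_eq_square)
  qed (use L_pos in auto)
  then have "((\<lambda>s. sin (\<theta> s) * (sin (\<theta> s) * \<kappa> s)) has_integral pi * of_int \<omega>) {0..L}"
    by (rule has_integral_eq_rhs) (use winding in \<open>unfold end_angle, simp add: field_simps\<close>)
  \<comment> \<open>Pairing \<open>sin \<theta>\<close> with \<open>sin \<theta> \<kappa>\<close>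
    puts the winding number on the left. Since the second factor is at most the bending integral,
    \<open>sin \<theta>\<close> cannot be small in mean square.\<close>
  then have cs: "(pi * of_int \<omega>)\<^sup>2 \<le> integral {0..L} (\<lambda>s. (sin (\<theta> s))\<^sup>2) * integral {0..L} (\<lambda>s. (sin (\<theta> s) * \<kappa> s)\<^sup>2)"
    using Cauchy_Schwarz_integral_Icc[OF L_pos cont] by (simp add: integral_unique)
  have "1 \<le> (pi * real_of_int \<omega>)\<^sup>2"
  proof -
    have "1 \<le> \<bar>real_of_int \<omega>\<bar>" using omega_nz by linarith
    then have "1 * 1 \<le> \<bar>pi\<bar> * \<bar>real_of_int \<omega>\<bar>" using pi_ge_two by (intro mult_mono) auto
    then show ?thesis using abs_le_square_iff[of 1 "pi * real_of_int \<omega>"] by (simp add: abs_mult)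
  qed
  also note cs
  also have "integral {0..L} (\<lambda>s. (sin (\<theta> s))\<^sup>2) * integral {0..L} (\<lambda>s. (sin (\<theta> s) * \<kappa> s)\<^sup>2)
      \<le> integral {0..L} (\<lambda>s. (sin (\<theta> s))\<^sup>2) * K"
  proof (intro mult_left_mono integral_nonneg integrable_continuous_real continuous_intros)
    have "integral {0..L} (\<lambda>s. (sin (\<theta> s) * \<kappa> s)\<^sup>2) \<le> integral {0..L} (\<lambda>s. (\<kappa> s)\<^sup>2)"
    proof (intro integral_le integrable_continuous_real continuous_intros)
      show "(sin (\<theta> s) * \<kappa> s)\<^sup>2 \<le> (\<kappa> s)\<^sup>2" for s
        using mult_right_mono[of "(sin (\<theta> s))\<^sup>2" 1 "(\<kappa> s)\<^sup>2"] by (simp add: power_mult_distrib abs_square_le_1)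
    qed
    then show "integral {0..L} (\<lambda>s. (sin (\<theta> s) * \<kappa> s)\<^sup>2) \<le> K" using bending by linarith
  qed auto
  finally show "1 \<le> K * integral {0..L} (\<lambda>s. (sin (\<theta> s))\<^sup>2)"
    by (simp add: mult.commute)
  have "0 \<le> integral {0..L} (\<lambda>s. (\<kappa> s)\<^sup>2)"
    by (intro integral_nonneg integrable_continuous_real continuous_intros) auto
  then show "0 \<le> K" using bending by linarith
qed

text \<open>With the moment \<open>w\<close>, the function \<open>w sin \<theta>\<close> takes equal
  values at both ends, so integrating its derivative gives \<open>lam * ?S\<close> as the integral
  of \<open>w \<kappa> cos \<theta>\<close>. The latter is bounded by the bending integral, and
  \<open>?S\<close> can be divided out because \<open>1 \<le> K * ?S\<close>.\<close>

lemma lam_bound: "lam \<le> B * K * (2 * K + c0\<^sup>2 * L)"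
proof -
  let ?w = "\<lambda>s. \<beta> (\<rho> s) * (\<kappa> s - c0)"
  let ?S = "integral {0..L} (\<lambda>s. (sin (\<theta> s))\<^sup>2)"
  have "((\<lambda>s. ?w s * \<kappa> s * cos (\<theta> s) - lam * (sin (\<theta> s))\<^sup>2) has_integral
      ?w L * sin (\<theta> L) - ?w 0 * sin (\<theta> 0)) {0..L}"
  proof (rule has_integral_real_derivative)
    fix s assume s: "s \<in> {0..L}"
    show "((\<lambda>s. ?w s * sin (\<theta> s)) has_real_derivative
        ?w s * \<kappa> s * cos (\<theta> s) - lam * (sin (\<theta> s))\<^sup>2) (at s within {0..L})"
      by (rule DERIV_cong[OF DERIV_mult[OF moment_deriv[OF s] DERIV_chain2[OF DERIV_sin theta_deriv[OF s]]]])
         (simp add: power2_eq_square algebra_simps)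
  qed (use L_pos in auto)
  then have 1: "((\<lambda>s. ?w s * \<kappa> s * cos (\<theta> s) - lam * (sin (\<theta> s))\<^sup>2) has_integral 0) {0..L}"
    by (simp add: end_angle periodic)
  have "((\<lambda>s. lam * (sin (\<theta> s))\<^sup>2) has_integral lam * ?S) {0..L}"
    by (intro has_integral_mult_right integrable_integral integrable_continuous_real continuous_intros)
  from has_integral_add[OF 1 this]
  have "((\<lambda>s. ?w s * \<kappa> s * cos (\<theta> s)) has_integral lam * ?S) {0..L}" by simp
  moreover have "((\<lambda>s. B * (2 * (\<kappa> s)\<^sup>2 + c0\<^sup>2)) has_integral
      B * (2 * integral {0..L} (\<lambda>s. (\<kappa> s)\<^sup>2) + c0\<^sup>2 * L)) {0..L}"
    using has_integral_const_real[of "c0\<^sup>2" 0 L] L_pos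
    by (intro has_integral_mult_right has_integral_add integrable_integral
        integrable_continuous_real continuous_intros) (auto simp: mult.commute)
  ultimately have "lam * ?S \<le> B * (2 * integral {0..L} (\<lambda>s. (\<kappa> s)\<^sup>2) + c0\<^sup>2 * L)"
  proof (rule has_integral_le)
    fix s assume s: "s \<in> {0..L}"
    have "?w s * \<kappa> s * cos (\<theta> s) \<le> \<bar>?w s * \<kappa> s * cos (\<theta> s)\<bar>" by simp
    also have "\<dots> = \<beta> (\<rho> s) * (\<bar>(\<kappa> s - c0) * \<kappa> s\<bar> * \<bar>cos (\<theta> s)\<bar>)"
      using beta_pos[OF s] by (simp add: abs_mult)
    also have "\<dots> \<le> B * ((2 * (\<kappa> s)\<^sup>2 + c0\<^sup>2) * 1)"
    proof (intro mult_mono)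
      have "2 * (\<kappa> s)\<^sup>2 + c0\<^sup>2 - (\<kappa> s - c0) * \<kappa> s = (\<kappa> s + c0)\<^sup>2 / 2 + (\<kappa> s)\<^sup>2 / 2 + c0\<^sup>2 / 2"
        "2 * (\<kappa> s)\<^sup>2 + c0\<^sup>2 + (\<kappa> s - c0) * \<kappa> s = (\<kappa> s - c0)\<^sup>2 / 2 + 5 / 2 * (\<kappa> s)\<^sup>2 + c0\<^sup>2 / 2"
        by (simp_all add: power2_eq_square field_simps)
      moreover have "0 \<le> (\<kappa> s + c0)\<^sup>2" "0 \<le> (\<kappa> s - c0)\<^sup>2" "0 \<le> (\<kappa> s)\<^sup>2" "0 \<le> c0\<^sup>2" by auto
      ultimately show "\<bar>(\<kappa> s - c0) * \<kappa> s\<bar> \<le> 2 * (\<kappa> s)\<^sup>2 + c0\<^sup>2" by linarith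
    qed (use beta_bounds[OF s] const_nonneg in auto)
    finally show "?w s * \<kappa> s * cos (\<theta> s) \<le> B * (2 * (\<kappa> s)\<^sup>2 + c0\<^sup>2)" by simp
  qed
  also have "\<dots> \<le> B * (2 * K + c0\<^sup>2 * L)" using const_nonneg bending by (intro mult_left_mono) auto
  finally have *: "lam * ?S \<le> B * (2 * K + c0\<^sup>2 * L)" .
  have "lam \<le> lam * (K * ?S)" using mult_left_mono[OF sin_square_lower(1) lam_nonneg] by simp
  also have "\<dots> = K * (lam * ?S)" by simp
  also have "\<dots> \<le> K * (B * (2 * K + c0\<^sup>2 * L))" using * sin_square_lower(2) by (rule mult_left_mono)
  finally show ?thesis by (simp add: algebra_simps)
qed

text \<open>Somewhere \<kappa> equals its mean \<open>2 pi \<omega> / L\<close>. From that point the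
  moment changes by at most \<open>\<Lambda> L\<close>, and dividing by
  \<open>\<beta> \<ge> b\<close> returns to the curvature.\<close>

lemma curvature_bound:
  assumes "lam \<le> \<Lambda>" "s \<in> {0..L}"
  shows "\<bar>\<kappa> s - c0\<bar> \<le> (B * \<bar>2 * pi * of_int \<omega> / L - c0\<bar> + \<Lambda> * L) / b"
proof -
  let ?w = "\<lambda>s. \<beta> (\<rho> s) * (\<kappa> s - c0)"
  obtain t where t: "t \<in> {0..L}" "\<theta> L - \<theta> 0 = \<kappa> t * (L - 0)"
    using mean_value_Icc[OF _ theta_deriv] L_pos by auto
  have kt: "\<kappa> t = 2 * pi * of_int \<omega> / L" using t(2) winding L_pos by (simp add: field_simps)
  have "\<bar>?w s - ?w t\<bar> \<le> \<Lambda> * (L - 0)"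
  proof (rule derivative_bound_Icc[OF moment_deriv _ assms(2) t(1)])
    show "\<bar>- lam * sin (\<theta> x)\<bar> \<le> \<Lambda>" for x
      using mult_mono[OF assms(1) abs_sin_le_one[of "\<theta> x"]] lam_nonneg assms(1) by (simp add: abs_mult)
  qed
  moreover have "\<bar>?w t\<bar> \<le> B * \<bar>\<kappa> t - c0\<bar>"
    using beta_bounds(2)[OF t(1)] beta_pos[OF t(1)] by (auto simp: abs_mult intro!: mult_right_mono)
  ultimately have "\<bar>?w s\<bar> \<le> B * \<bar>\<kappa> t - c0\<bar> + \<Lambda> * L" by simp
  moreover have "b * \<bar>\<kappa> s - c0\<bar> \<le> \<bar>?w s\<bar>"
    using beta_bounds(1)[OF assms(2)] b_pos by (auto simp: abs_mult intro!: mult_right_mono)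
  ultimately show ?thesis unfolding kt using b_pos by (simp add: field_simps)
qed

text \<open>Both \<open>\<sigma>\<close> and \<open>\<sigma>1\<close> have mean zero, hence vanish somewhere.\<close>

lemma slope_bound:
  assumes "\<And>s t. s \<in> {0..L} \<Longrightarrow> t \<in> {0..L} \<Longrightarrow>
      \<bar>\<beta>1 (\<rho> s) * (\<kappa> s - c0)\<^sup>2 - \<beta>1 (\<rho> t) * (\<kappa> t - c0)\<^sup>2\<bar> \<le> D"
    and "s \<in> {0..L}"
  shows "\<bar>\<sigma> s\<bar> \<le> D * L / (2 * \<mu>)"
proof -
  obtain t where t: "t \<in> {0..L}" "\<sigma> L - \<sigma> 0 = \<sigma>1 t * (L - 0)"
    using mean_value_Icc[OF _ sigma_deriv] L_pos by auto
  then have [simp]: "\<sigma>1 t = 0" using periodic L_pos by simp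
  obtain r where r: "r \<in> {0..L}" "\<rho> L - \<rho> 0 = \<sigma> r * (L - 0)"
    using mean_value_Icc[OF _ rho_deriv] L_pos by auto
  then have [simp]: "\<sigma> r = 0" using periodic L_pos by simp
  have "\<bar>\<sigma> s - \<sigma> r\<bar> \<le> D / (2 * \<mu>) * (L - 0)"
  proof (rule derivative_bound_Icc[OF sigma_deriv _ assms(2) r(1)])
    fix x assume x: "x \<in> {0..L}"
    \<comment> \<open>Subtracting the density equation at the zero \<open>t\<close> of \<sigma>1
      eliminates the constant \<open>m\<close>, about which no bound is assumed. What remains is the
      oscillation of \<open>\<beta>1(\<rho>) (\<kappa> - c0)^2\<close>.\<close>
    have "\<mu> * \<bar>\<sigma>1 x\<bar> = \<bar>\<mu> * \<sigma>1 x - \<mu> * \<sigma>1 t\<bar>" using mu_pos by (simp add: abs_mult)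
    also have "\<dots> \<le> D / 2"
      using assms(1)[OF x t(1)] unfolding density[OF x] density[OF t(1)] by (auto simp: abs_le_iff field_simps)
    finally show "\<bar>\<sigma>1 x\<bar> \<le> D / (2 * \<mu>)" using mu_pos by (simp add: field_simps)
  qed
  then show ?thesis by simp
qed

text \<open>
  A profile that is slow at the unstable equilibrium \<open>\<theta> \<equiv> \<pi>\<close> of the pendulum stays close to it by
  Gronwall and cannot wind around; away from the equilibrium the pendulum is faster, because
  \<open>\<kappa>\<^sup>2 / 2 - lam cos \<theta> / \<beta>\<close> is almost conserved.
\<close>

lemma curvature_lower:
  assumes Lam: "lam \<le> \<Lambda>" and N: "\<And>s. s \<in> {0..L} \<Longrightarrow> \<bar>\<kappa> s - c0\<bar> \<le> N"
    and M: "\<And>s. s \<in> {0..L} \<Longrightarrow> \<bar>\<kappa> s\<bar> \<le> M"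
    and eps: "\<And>s. s \<in> {0..L} \<Longrightarrow> \<bar>\<sigma> s\<bar> \<le> \<epsilon>" "\<epsilon> \<le> 1"
    and P: "P = B1 * N / b" and Q: "Q = \<Lambda> * B1 / b\<^sup>2" and "s \<in> {0..L}"
  shows "(\<kappa> s)\<^sup>2 \<ge> pi\<^sup>2 * exp (- (2 + \<Lambda> / b) * L) - (P\<^sup>2 + 2 * L * (M * P + 2 * Q)) * \<epsilon>"
proof -
  \<comment> \<open>The angle equation is read as a pendulum
    \<open>\<kappa>1 = - A sin \<theta> - e\<close>, with variable coefficient \<open>A\<close> and
    a defect \<open>e\<close>. Both \<open>e\<close> and the derivative \<open>A'\<close> carry a
    factor \<sigma> and are therefore of order \<epsilon>.\<close>
  define e where "e s = \<beta>1 (\<rho> s) * \<sigma> s * (\<kappa> s - c0) / \<beta> (\<rho> s)" for s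
  define A where "A s = lam / \<beta> (\<rho> s)" for s
  define A' where "A' s = - lam * (\<beta>1 (\<rho> s) * \<sigma> s) / (\<beta> (\<rho> s))\<^sup>2" for s
  have zero: "0 \<in> {0..L}" using L_pos by simp
  have nonneg: "0 \<le> \<epsilon>" "0 \<le> \<Lambda>" "0 \<le> N" "0 \<le> M"
    using eps(1)[OF zero] Lam lam_nonneg N[OF zero] M[OF zero] by linarith+
  then have PQ: "0 \<le> P" "0 \<le> Q" using P Q const_nonneg b_pos by auto
  have kappa1: "\<kappa>1 s = - A s * sin (\<theta> s) - e s" if "s \<in> {0..L}" for s
    using elastica[OF that] beta_pos[OF that] unfolding A_def e_def by (simp add: field_simps)
  have A_bounds: "0 \<le> A s" "A s \<le> \<Lambda> / b" if "s \<in> {0..L}" for s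
    using beta_bounds(1)[OF that] beta_pos[OF that] lam_nonneg Lam b_pos
    unfolding A_def by (auto intro!: frac_le)
  have A_deriv: "(A has_real_derivative A' s) (at s within {0..L})" if "s \<in> {0..L}" for s
    unfolding A_def A'_def using beta_pos[OF that]
    by (auto intro!: derivative_eq_intros beta_rho_deriv that simp: power2_eq_square)
  have e_bound: "\<bar>e s\<bar> \<le> P * \<epsilon>" if "s \<in> {0..L}" for s
  proof -
    have "\<bar>e s\<bar> \<le> (B1 * \<epsilon> * N) / b"
      unfolding e_def abs_divide abs_mult
      using beta_bounds(1,3)[OF that] beta_pos[OF that] b_pos N[OF that] eps(1)[OF that] nonneg const_nonneg
      by (intro frac_le mult_mono mult_nonneg_nonneg) auto
    then show ?thesis by (simp add: P mult_ac)
  qed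
  have A'_bound: "\<bar>A' s\<bar> \<le> Q * \<epsilon>" if "s \<in> {0..L}" for s
  proof -
    have "\<bar>A' s\<bar> \<le> (\<Lambda> * (B1 * \<epsilon>)) / b\<^sup>2"
      unfolding A'_def abs_divide abs_mult abs_minus_cancel
      using beta_bounds(1,3)[OF that] beta_pos[OF that] b_pos Lam lam_nonneg eps(1)[OF that] nonneg const_nonneg
      by (intro frac_le mult_mono mult_nonneg_nonneg) (auto intro!: power_mono)
    then show ?thesis by (simp add: Q mult_ac)
  qed
  obtain t and k :: int where t: "t \<in> {0..L}" and tk: "\<theta> t = pi + 2 * pi * of_int k"
    using winding_attains_angle[OF _ continuous_profile(1) winding omega_nz] L_pos by auto
  define p where "p s = \<theta> s - \<theta> t" for s
  have sin_p: "sin (\<theta> s) = - sin (p s)" for s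
  proof -
    have "\<theta> s = (p s + pi) + 2 * pi * of_int k" unfolding p_def tk by simp
    then show ?thesis by (simp add: sin_add cos_add sin_int_2pin cos_int_2pin)
  qed
  have cos_t: "cos (\<theta> t) = -1"
    unfolding tk by (simp add: cos_add sin_int_2pin cos_int_2pin)
  define C where "C = 2 + \<Lambda> / b"
  \<comment> \<open>Squared distance to the equilibrium in phase space. The constant
    \<open>(P * \<epsilon>)^2\<close> absorbs the forcing \<open>e\<close>, so that the homogeneous
    Gronwall inequality applies; at \<open>t\<close> only \<open>\<kappa>^2\<close> and this
    constant survive because \<open>p t = 0\<close>.\<close>
  define v where "v s = (p s)\<^sup>2 + (\<kappa> s)\<^sup>2 + (P * \<epsilon>)\<^sup>2" for s
  have v_deriv: "(v has_real_derivative 2 * p s * \<kappa> s + 2 * \<kappa> s * (A s * sin (p s) - e s)) (at s within {0..L})"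
    if "s \<in> {0..L}" for s
    unfolding v_def p_def
    by (rule derivative_eq_intros theta_deriv kappa_deriv that refl)+
       (simp add: kappa1[OF that] sin_p[unfolded p_def])
  have v_bound: "\<bar>2 * p s * \<kappa> s + 2 * \<kappa> s * (A s * sin (p s) - e s)\<bar> \<le> C * v s"
    if "s \<in> {0..L}" for s
  proof -
    have amgm: "2 * (x * y) \<le> x\<^sup>2 + y\<^sup>2" for x y :: real
      using zero_le_power2[of "x - y"] by (simp add: power2_eq_square algebra_simps)
    have "\<bar>A s * sin (p s) - e s\<bar> \<le> \<Lambda> / b * \<bar>p s\<bar> + P * \<epsilon>"
    proof -
      have "\<bar>A s * sin (p s)\<bar> \<le> \<Lambda> / b * \<bar>p s\<bar>"
        unfolding abs_mult using A_bounds[OF that] abs_sin_x_le_abs_x[of "p s"] by (intro mult_mono) auto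
      then show ?thesis using e_bound[OF that] by linarith
    qed
    then have "\<bar>\<kappa> s\<bar> * \<bar>A s * sin (p s) - e s\<bar> \<le> \<bar>\<kappa> s\<bar> * (\<Lambda> / b * \<bar>p s\<bar> + P * \<epsilon>)"
      by (intro mult_left_mono) auto
    then have "\<bar>2 * p s * \<kappa> s + 2 * \<kappa> s * (A s * sin (p s) - e s)\<bar>
        \<le> 2 * (\<bar>p s\<bar> * \<bar>\<kappa> s\<bar>) + 2 * (\<bar>\<kappa> s\<bar> * (\<Lambda> / b * \<bar>p s\<bar> + P * \<epsilon>))"
      using abs_triangle_ineq[of "2 * p s * \<kappa> s" "2 * \<kappa> s * (A s * sin (p s) - e s)"]
      by (simp add: abs_mult)
    also have "\<dots> = (1 + \<Lambda> / b) * (2 * (\<bar>p s\<bar> * \<bar>\<kappa> s\<bar>)) + 2 * (\<bar>\<kappa> s\<bar> * (P * \<epsilon>))"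
      by (simp add: algebra_simps)
    also have "\<dots> \<le> (1 + \<Lambda> / b) * ((p s)\<^sup>2 + (\<kappa> s)\<^sup>2) + ((\<kappa> s)\<^sup>2 + (P * \<epsilon>)\<^sup>2)"
    proof (rule add_mono)
      show "(1 + \<Lambda> / b) * (2 * (\<bar>p s\<bar> * \<bar>\<kappa> s\<bar>)) \<le> (1 + \<Lambda> / b) * ((p s)\<^sup>2 + (\<kappa> s)\<^sup>2)"
        using amgm[of "\<bar>p s\<bar>" "\<bar>\<kappa> s\<bar>"] nonneg b_pos by (intro mult_left_mono) auto
      show "2 * (\<bar>\<kappa> s\<bar> * (P * \<epsilon>)) \<le> (\<kappa> s)\<^sup>2 + (P * \<epsilon>)\<^sup>2"
        using amgm[of "\<bar>\<kappa> s\<bar>" "P * \<epsilon>"] by simp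
    qed
    also have "\<dots> \<le> (1 + \<Lambda> / b) * v s + v s"
    proof (rule add_mono)
      show "(1 + \<Lambda> / b) * ((p s)\<^sup>2 + (\<kappa> s)\<^sup>2) \<le> (1 + \<Lambda> / b) * v s"
        unfolding v_def using nonneg b_pos by (intro mult_left_mono) auto
    qed (simp add: v_def)
    finally show ?thesis unfolding C_def by (simp add: algebra_simps)
  qed
  have "C \<ge> 0" unfolding C_def using nonneg b_pos by auto
  have v_le: "v x \<le> v t * exp (C * L)" if "x \<in> {0..L}" for x
    using Gronwall_Icc[OF v_deriv v_bound \<open>C \<ge> 0\<close> _ that t] by (simp add: v_def)
  \<comment> \<open>The angles at the two ends differ by at least a full turn, so one end is at
    angular distance at least pi from the equilibrium. Propagating \<open>v\<close> from
    \<open>t\<close> to that end yields a lower bound for the speed at \<open>t\<close>.\<close>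
  have "2 * pi \<le> \<bar>p L - p 0\<bar>"
  proof -
    have "1 \<le> \<bar>real_of_int \<omega>\<bar>" using omega_nz by linarith
    then show ?thesis using mult_left_mono[of 1 "\<bar>real_of_int \<omega>\<bar>" "2 * pi"] winding
      by (simp add: p_def abs_mult)
  qed
  then have "pi \<le> \<bar>p L\<bar> \<or> pi \<le> \<bar>p 0\<bar>" by linarith
  then obtain x where x: "x \<in> {0..L}" "pi \<le> \<bar>p x\<bar>"
    using that[of L] that[of 0] L_pos by auto
  have "pi\<^sup>2 \<le> (p x)\<^sup>2" using x(2) by (simp add: abs_le_square_iff[symmetric])
  also have "\<dots> \<le> v x" by (simp add: v_def)
  also have "\<dots> \<le> v t * exp (C * L)" by (rule v_le[OF x(1)])
  finally have "pi\<^sup>2 * exp (- (C * L)) \<le> v t * exp (C * L) * exp (- (C * L))"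
    by (intro mult_right_mono) auto
  then have kt: "pi\<^sup>2 * exp (- (C * L)) \<le> (\<kappa> t)\<^sup>2 + P\<^sup>2 * \<epsilon>\<^sup>2"
    by (simp add: mult.assoc exp_add[symmetric] v_def p_def power_mult_distrib)
  \<comment> \<open>The pendulum energy. In its derivative the leading terms cancel and only
    contributions of \<open>e\<close> and \<open>A'\<close> remain, hence it is constant up to order
    \<epsilon>.\<close>
  define H where "H s = (\<kappa> s)\<^sup>2 / 2 - A s * cos (\<theta> s)" for s
  have "\<bar>H s - H t\<bar> \<le> (M * P + Q) * \<epsilon> * (L - 0)"
  proof (rule derivative_bound_Icc[OF _ _ assms(8) t])
    fix s assume s: "s \<in> {0..L}"
    show "(H has_real_derivative - \<kappa> s * e s - A' s * cos (\<theta> s)) (at s within {0..L})"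
      unfolding H_def
      by (auto intro!: derivative_eq_intros kappa_deriv A_deriv theta_deriv s
          simp: kappa1[OF s] field_simps)
    have "\<bar>- \<kappa> s * e s - A' s * cos (\<theta> s)\<bar> \<le> \<bar>\<kappa> s\<bar> * \<bar>e s\<bar> + \<bar>A' s\<bar> * \<bar>cos (\<theta> s)\<bar>"
      using abs_triangle_ineq4[of "- \<kappa> s * e s" "A' s * cos (\<theta> s)"] by (simp add: abs_mult)
    also have "\<dots> \<le> M * (P * \<epsilon>) + (Q * \<epsilon>) * 1"
      using M[OF s] e_bound[OF s] A'_bound[OF s] nonneg PQ
      by (intro add_mono mult_mono) auto
    finally show "\<bar>- \<kappa> s * e s - A' s * cos (\<theta> s)\<bar> \<le> (M * P + Q) * \<epsilon>" by (simp add: algebra_simps)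
  qed
  moreover have "\<bar>A s - A t\<bar> \<le> Q * \<epsilon> * (L - 0)"
    by (rule derivative_bound_Icc[OF A_deriv A'_bound assms(8) t])
  \<comment> \<open>The potential \<open>- A cos \<theta>\<close> is at most \<open>A s\<close> at
    \<open>s\<close>, whereas at \<open>t\<close> it equals \<open>A t\<close>. As
    \<open>A s\<close> and \<open>A t\<close> differ by order \<epsilon>, the kinetic part at
    \<open>s\<close> is at least the one at \<open>t\<close> up to such errors.\<close>
  moreover have "- A s \<le> A s * cos (\<theta> s)"
    using mult_left_mono[OF cos_ge_minus_one[of "\<theta> s"] A_bounds(1)[OF assms(8)]] by simp
  ultimately have "(\<kappa> s)\<^sup>2 / 2 \<ge> (\<kappa> t)\<^sup>2 / 2 - (M * P + Q) * \<epsilon> * L - Q * \<epsilon> * L"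
    unfolding H_def cos_t by simp
  then have "(\<kappa> s)\<^sup>2 \<ge> (\<kappa> t)\<^sup>2 - 2 * L * (M * P + 2 * Q) * \<epsilon>"
    by (simp add: algebra_simps)
  moreover have "P\<^sup>2 * \<epsilon>\<^sup>2 \<le> P\<^sup>2 * \<epsilon>"
    using eps(2) nonneg(1) mult_left_mono[of \<epsilon> 1 \<epsilon>] by (intro mult_left_mono) (auto simp: power2_eq_square)
  ultimately show ?thesis
    using kt by (simp add: C_def algebra_simps)
qed

text \<open>
  Integrating \<open>(sin \<theta> / \<kappa>)' = cos \<theta> - sin \<theta> \<kappa>' / \<kappa>\<^sup>2\<close> over the closed curve bounds the multiplier
  by the slope of the density.
\<close>

lemma lam_le_slope:
  assumes "0 < \<delta>" and low: "\<And>s. s \<in> {0..L} \<Longrightarrow> \<delta> \<le> (\<kappa> s)\<^sup>2"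
    and N: "\<And>s. s \<in> {0..L} \<Longrightarrow> \<bar>\<kappa> s - c0\<bar> \<le> N"
    and M: "\<And>s. s \<in> {0..L} \<Longrightarrow> \<bar>\<kappa> s\<bar> \<le> M"
    and r: "\<And>s. s \<in> {0..L} \<Longrightarrow> \<bar>\<sigma> s\<bar> \<le> r"
    and P: "P = B1 * N / b"
  shows "lam \<le> K * B * M\<^sup>2 * P * L / \<delta> * r"
proof -
  define e where "e s = \<beta>1 (\<rho> s) * \<sigma> s * (\<kappa> s - c0) / \<beta> (\<rho> s)" for s
  let ?S = "integral {0..L} (\<lambda>s. (sin (\<theta> s))\<^sup>2)"
  have zero: "0 \<in> {0..L}" using L_pos by simp
  have nz: "\<kappa> s \<noteq> 0" if "s \<in> {0..L}" for s using low[OF that] \<open>0 < \<delta>\<close> by auto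
  have nonneg: "0 \<le> r" "0 \<le> N" "0 < M"
    using r[OF zero] N[OF zero] M[OF zero] nz[OF zero] by linarith+
  then have "0 \<le> P" using P const_nonneg b_pos by auto
  have kappa1: "\<kappa>1 s = - (lam / \<beta> (\<rho> s)) * sin (\<theta> s) - e s" if "s \<in> {0..L}" for s
    using elastica[OF that] beta_pos[OF that] unfolding e_def by (simp add: field_simps)
  have e_bound: "\<bar>e s\<bar> \<le> P * r" if "s \<in> {0..L}" for s
  proof -
    have "\<bar>e s\<bar> \<le> (B1 * r * N) / b"
      unfolding e_def abs_divide abs_mult
      using beta_bounds(1,3)[OF that] beta_pos[OF that] b_pos N[OF that] r[OF that] nonneg const_nonneg
      by (intro frac_le mult_mono mult_nonneg_nonneg) auto
    then show ?thesis by (simp add: P mult_ac)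
  qed
  have I0: "((\<lambda>s. cos (\<theta> s) - sin (\<theta> s) * \<kappa>1 s / (\<kappa> s)\<^sup>2) has_integral
      sin (\<theta> L) / \<kappa> L - sin (\<theta> 0) / \<kappa> 0) {0..L}"
  proof (rule has_integral_real_derivative)
    fix s assume s: "s \<in> {0..L}"
    show "((\<lambda>s. sin (\<theta> s) / \<kappa> s) has_real_derivative
        cos (\<theta> s) - sin (\<theta> s) * \<kappa>1 s / (\<kappa> s)\<^sup>2) (at s within {0..L})"
      using nz[OF s] by (auto intro!: derivative_eq_intros theta_deriv kappa_deriv s
          simp: field_simps power2_eq_square)
  qed (use L_pos in auto)
  have "((\<lambda>s. cos (\<theta> s)) has_integral 0) {0..L}"
    using integrable_integral[of "\<lambda>s. cos (\<theta> s)" "{0..L}"]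
    by (simp add: closed integrable_continuous_real continuous_intros)
  from has_integral_diff[OF this I0] have I1: "((\<lambda>s. sin (\<theta> s) * \<kappa>1 s / (\<kappa> s)\<^sup>2) has_integral 0) {0..L}"
    by (simp add: end_angle periodic)
  \<comment> \<open>A lower bound for the integrand
    \<open>- sin \<theta> \<kappa>1 / \<kappa>^2\<close>, whose integral is zero. The pendulum part
    is nonnegative and at least \<open>lam sin^2 \<theta> / (B M^2)\<close>; the defect
    \<open>e\<close> contributes at least \<open>- P r / \<delta>\<close>.\<close>
  have "((\<lambda>s. lam / (B * M\<^sup>2) * (sin (\<theta> s))\<^sup>2 - P * r / \<delta>) has_integral
      lam / (B * M\<^sup>2) * ?S - P * r / \<delta> * L) {0..L}"
    using has_integral_const_real[of "P * r / \<delta>" 0 L] L_pos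
    by (intro has_integral_diff has_integral_mult_right integrable_integral
        integrable_continuous_real continuous_intros) (auto simp: mult.commute)
  from this has_integral_neg[OF I1] have "lam / (B * M\<^sup>2) * ?S - P * r / \<delta> * L \<le> - 0"
  proof (rule has_integral_le)
    fix s assume s: "s \<in> {0..L}"
    have "lam / (B * M\<^sup>2) * (sin (\<theta> s))\<^sup>2 \<le> lam / (\<beta> (\<rho> s) * (\<kappa> s)\<^sup>2) * (sin (\<theta> s))\<^sup>2"
    proof (intro mult_right_mono frac_le mult_mono)
      show "(\<kappa> s)\<^sup>2 \<le> M\<^sup>2" using M[OF s] nonneg by (simp add: abs_le_square_iff[symmetric])
    qed (use lam_nonneg beta_bounds[OF s] beta_pos[OF s] nz[OF s] const_nonneg in auto)
    moreover have "\<bar>sin (\<theta> s) * e s / (\<kappa> s)\<^sup>2\<bar> \<le> (1 * (P * r)) / \<delta>"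
      unfolding abs_divide abs_mult using e_bound[OF s] low[OF s] \<open>0 < \<delta>\<close> \<open>0 \<le> P\<close> nonneg
      by (intro frac_le mult_mono) auto
    moreover have "- (sin (\<theta> s) * \<kappa>1 s / (\<kappa> s)\<^sup>2) =
        lam / (\<beta> (\<rho> s) * (\<kappa> s)\<^sup>2) * (sin (\<theta> s))\<^sup>2 + sin (\<theta> s) * e s / (\<kappa> s)\<^sup>2"
      unfolding kappa1[OF s] using nz[OF s] beta_pos[OF s] by (simp add: field_simps power2_eq_square)
    ultimately show "lam / (B * M\<^sup>2) * (sin (\<theta> s))\<^sup>2 - P * r / \<delta> \<le> - (sin (\<theta> s) * \<kappa>1 s / (\<kappa> s)\<^sup>2)"
      by linarith
  qed
  then have "lam * ?S \<le> B * M\<^sup>2 * (P * r / \<delta> * L)"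
    using const_nonneg nonneg by (simp add: field_simps)
  then have "K * (lam * ?S) \<le> K * (B * M\<^sup>2 * (P * r / \<delta> * L))"
    by (rule mult_left_mono) (rule sin_square_lower(2))
  moreover have "lam \<le> lam * (K * ?S)" using mult_left_mono[OF sin_square_lower(1) lam_nonneg] by simp
  ultimately show ?thesis by (simp add: mult_ac)
qed

text \<open>The slope \<open>r\<close> of the density controls itself with a factor of order \<open>1 / \<mu>\<close>.\<close>

lemma constant_of_large_mu:
  assumes "0 < \<delta>" and low: "\<And>s. s \<in> {0..L} \<Longrightarrow> \<delta> \<le> (\<kappa> s)\<^sup>2"
    and N: "\<And>s. s \<in> {0..L} \<Longrightarrow> \<bar>\<kappa> s - c0\<bar> \<le> N"
    and M: "\<And>s. s \<in> {0..L} \<Longrightarrow> \<bar>\<kappa> s\<bar> \<le> M"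
    and P: "P = B1 * N / b" and R: "R = K * B * M\<^sup>2 * P * L / \<delta>"
    and large: "(B2 * N\<^sup>2 + 2 * B1 * N * (R / b + P)) * L\<^sup>2 < 2 * \<mu>"
    and "s \<in> {0..L}"
  shows "\<sigma> s = 0" "\<kappa> s = 2 * pi * of_int \<omega> / L"
proof -
  have zero: "0 \<in> {0..L}" using L_pos by simp
  obtain x where x: "x \<in> {0..L}" "\<And>s. s \<in> {0..L} \<Longrightarrow> \<bar>\<sigma> s\<bar> \<le> \<bar>\<sigma> x\<bar>"
    using continuous_attains_sup[of "{0..L}" "\<lambda>s. \<bar>\<sigma> s\<bar>"] zero
      continuous_on_rabs[OF continuous_profile(4)] by (metis compact_Icc empty_iff)
  \<comment> \<open>The maximum is attained at \<open>x\<close>, so a bound on \<sigma> at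
    \<open>x\<close> in terms of \<open>r\<close> is an inequality of \<open>r\<close> with
    itself.\<close>
  define r where "r = \<bar>\<sigma> x\<bar>"
  have r: "\<bar>\<sigma> s\<bar> \<le> r" if "s \<in> {0..L}" for s using x(2)[OF that] by (simp add: r_def)
  have nonneg: "0 \<le> r" "0 \<le> N"
    using r[OF zero] N[OF zero] by linarith+
  have "lam \<le> R * r" unfolding R by (rule lam_le_slope[OF assms(1) low N M r P])
  have kappa1_bound: "\<bar>\<kappa>1 s\<bar> \<le> (R / b + P) * r" if "s \<in> {0..L}" for s
  proof -
    have "\<kappa>1 s = - (lam * sin (\<theta> s) + \<beta>1 (\<rho> s) * \<sigma> s * (\<kappa> s - c0)) / \<beta> (\<rho> s)"
      using elastica[OF that] beta_pos[OF that] by (simp add: field_simps)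
    then have "\<bar>\<kappa>1 s\<bar> = \<bar>lam * sin (\<theta> s) + \<beta>1 (\<rho> s) * \<sigma> s * (\<kappa> s - c0)\<bar> / \<bar>\<beta> (\<rho> s)\<bar>"
      by (simp only: abs_divide abs_minus_cancel)
    also have "\<dots> \<le> (lam * 1 + B1 * r * N) / b"
    proof (rule frac_le)
      have "\<bar>lam * sin (\<theta> s)\<bar> \<le> lam * 1"
        unfolding abs_mult using lam_nonneg by (intro mult_mono) auto
      moreover have "\<bar>\<beta>1 (\<rho> s) * \<sigma> s * (\<kappa> s - c0)\<bar> \<le> B1 * r * N"
        unfolding abs_mult using beta_bounds[OF that] r[OF that] N[OF that] nonneg const_nonneg
        by (intro mult_mono mult_nonneg_nonneg) auto
      ultimately show "\<bar>lam * sin (\<theta> s) + \<beta>1 (\<rho> s) * \<sigma> s * (\<kappa> s - c0)\<bar> \<le> lam * 1 + B1 * r * N"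
        by linarith
      show "0 \<le> lam * 1 + B1 * r * N" using lam_nonneg nonneg const_nonneg by simp
    qed (use b_pos beta_bounds[OF that] in auto)
    also have "\<dots> \<le> (R * r + B1 * r * N) / b" using \<open>lam \<le> R * r\<close> b_pos by (intro divide_right_mono) auto
    finally show ?thesis using b_pos by (simp add: P field_simps)
  qed
  \<comment> \<open>\<open>S * r\<close> bounds the derivative of
    \<open>\<beta>1(\<rho>) (\<kappa> - c0)^2\<close>: one summand comes from the derivative of
    \<open>\<beta>1(\<rho>)\<close>, the other from \<open>\<kappa>1\<close>, and both are linear in
    \<open>r\<close>. The oscillation over the interval is thus at most
    \<open>S r L\<close>.\<close>
  define S where "S = B2 * N\<^sup>2 + 2 * B1 * N * (R / b + P)"
  have "\<bar>\<sigma> x\<bar> \<le> S * r * L * L / (2 * \<mu>)"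
  proof (rule slope_bound[OF _ x(1)])
    fix s t assume st: "s \<in> {0..L}" "t \<in> {0..L}"
    have "\<bar>\<beta>1 (\<rho> s) * (\<kappa> s - c0)\<^sup>2 - \<beta>1 (\<rho> t) * (\<kappa> t - c0)\<^sup>2\<bar> \<le> S * r * (L - 0)"
    proof (rule derivative_bound_Icc[where f = "\<lambda>s. \<beta>1 (\<rho> s) * (\<kappa> s - c0)\<^sup>2"])
      fix s assume s: "s \<in> {0..L}"
      let ?g' = "\<beta>2 (\<rho> s) * \<sigma> s * (\<kappa> s - c0)\<^sup>2 + 2 * (\<beta>1 (\<rho> s) * (\<kappa> s - c0) * \<kappa>1 s)"
      show "((\<lambda>s. \<beta>1 (\<rho> s) * (\<kappa> s - c0)\<^sup>2) has_real_derivative ?g') (at s within {0..L})"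
        by (rule derivative_eq_intros beta1_rho_deriv kappa_deriv s refl)+
           (simp add: power2_eq_square algebra_simps)
      have "\<bar>\<beta>2 (\<rho> s) * \<sigma> s * (\<kappa> s - c0)\<^sup>2\<bar> \<le> B2 * r * N\<^sup>2"
        unfolding abs_mult using beta_bounds[OF s] r[OF s] N[OF s] nonneg const_nonneg
        by (intro mult_mono mult_nonneg_nonneg) (auto simp: abs_le_square_iff[symmetric])
      moreover have "\<bar>\<beta>1 (\<rho> s) * (\<kappa> s - c0) * \<kappa>1 s\<bar> \<le> B1 * N * ((R / b + P) * r)"
        unfolding abs_mult using beta_bounds[OF s] kappa1_bound[OF s] N[OF s] nonneg const_nonneg
        by (intro mult_mono mult_nonneg_nonneg) auto
      ultimately have "\<bar>?g'\<bar> \<le> B2 * r * N\<^sup>2 + 2 * (B1 * N * ((R / b + P) * r))" by linarith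
      then show "\<bar>?g'\<bar> \<le> S * r" unfolding S_def by (simp add: algebra_simps)
    qed (use st in auto)
    then show "\<bar>\<beta>1 (\<rho> s) * (\<kappa> s - c0)\<^sup>2 - \<beta>1 (\<rho> t) * (\<kappa> t - c0)\<^sup>2\<bar> \<le> S * r * L" by simp
  qed
  then have "r * (2 * \<mu> - S * L\<^sup>2) \<le> 0"
    using mu_pos by (simp add: r_def field_simps power2_eq_square)
  moreover have "0 < 2 * \<mu> - S * L\<^sup>2" using large by (simp add: S_def)
  ultimately have "r = 0" using nonneg by (simp add: mult_le_0_iff)
  then show "\<sigma> s = 0" using r[OF assms(8)] by simp
  obtain t where t: "t \<in> {0..L}" "\<theta> L - \<theta> 0 = \<kappa> t * (L - 0)"
    using mean_value_Icc[OF _ theta_deriv] L_pos by auto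
  have "\<kappa> t = 2 * pi * of_int \<omega> / L" using t(2) winding L_pos by (simp add: field_simps)
  moreover have "\<bar>\<kappa> s - \<kappa> t\<bar> \<le> 0 * (L - 0)"
    using kappa1_bound \<open>r = 0\<close> by (intro derivative_bound_Icc[OF kappa_deriv _ assms(8) t(1)]) auto
  ultimately show "\<kappa> s = 2 * pi * of_int \<omega> / L" by simp
qed

end

text \<open>Each constant of the preceding estimates is a formula in the locale parameters alone,
  never in the profile or its multipliers. This is what permits a threshold for \<mu> ahead of the
  quantifiers over profiles.\<close>

lemma stationary_profile_large_mu:
  fixes L c0 b B B1 B2 K :: real and \<omega> :: int and \<beta> \<beta>1 \<beta>2 :: "real \<Rightarrow> real"
  shows "\<exists>\<mu>0>0. \<forall>\<mu>\<ge>\<mu>0. \<forall>lam m \<theta> \<kappa> \<kappa>1 \<rho> \<sigma> \<sigma>1.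
    stationary_profile L c0 \<mu> lam m b B B1 B2 K \<omega> \<beta> \<beta>1 \<beta>2 \<theta> \<kappa> \<kappa>1 \<rho> \<sigma> \<sigma>1 \<longrightarrow>
    (\<forall>s\<in>{0..L}. \<sigma> s = 0 \<and> \<kappa> s = 2 * pi * of_int \<omega> / L)"
proof -
  define \<Lambda> where "\<Lambda> = B * K * (2 * K + c0\<^sup>2 * L)"
  define N where "N = (B * \<bar>2 * pi * of_int \<omega> / L - c0\<bar> + \<Lambda> * L) / b"
  define M where "M = N + \<bar>c0\<bar>"
  define P where "P = B1 * N / b"
  define Q where "Q = \<Lambda> * B1 / b\<^sup>2"
  \<comment> \<open>Half of the leading term in the lower bound for \<open>\<kappa>^2\<close>; the
    other half is left for the error of order \<open>D / \<mu>\<close>.\<close>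
  define \<delta> where "\<delta> = pi\<^sup>2 * exp (- (2 + \<Lambda> / b) * L) / 2"
  define R where "R = K * B * M\<^sup>2 * P * L / \<delta>"
  define D where "D = B1 * N\<^sup>2 * L"
  define X where "X = D * (P\<^sup>2 + 2 * L * (M * P + 2 * Q)) / \<delta>"
  define Y where "Y = (B2 * N\<^sup>2 + 2 * B1 * N * (R / b + P)) * L\<^sup>2"
  \<comment> \<open>One summand per requirement: \<open>D\<close> makes the slope bound
    \<open>D / \<mu>\<close> at most 1, \<open>X\<close> makes the error in the lower bound for
    \<open>\<kappa>^2\<close> at most \<delta>, and \<open>Y\<close> closes the estimate of the
    slope by itself. Absolute values are taken because no signs of the parameters are known before a
    profile is given.\<close>
  define \<mu>0 where "\<mu>0 = 1 + \<bar>D\<bar> + \<bar>X\<bar> + \<bar>Y\<bar>"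
  have "\<delta> > 0" by (simp add: \<delta>_def)
  show ?thesis
  proof (intro exI conjI allI impI ballI)
    show "\<mu>0 > 0" by (simp add: \<mu>0_def add_nonneg_pos)
  next
    fix \<mu> lam m s :: real and \<theta> \<kappa> \<kappa>1 \<rho> \<sigma> \<sigma>1 :: "real \<Rightarrow> real"
    assume mu: "\<mu>0 \<le> \<mu>" and "s \<in> {0..L}"
      and "stationary_profile L c0 \<mu> lam m b B B1 B2 K \<omega> \<beta> \<beta>1 \<beta>2 \<theta> \<kappa> \<kappa>1 \<rho> \<sigma> \<sigma>1"
    then interpret stationary_profile L c0 \<mu> lam m b B B1 B2 K \<omega> \<beta> \<beta>1 \<beta>2 \<theta> \<kappa> \<kappa>1 \<rho> \<sigma> \<sigma>1 by simp
    have Lam: "lam \<le> \<Lambda>" unfolding \<Lambda>_def by (rule lam_bound)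
    have N: "\<bar>\<kappa> s - c0\<bar> \<le> N" if "s \<in> {0..L}" for s
      unfolding N_def by (rule curvature_bound[OF Lam that])
    have M: "\<bar>\<kappa> s\<bar> \<le> M" if "s \<in> {0..L}" for s
      using N[OF that] unfolding M_def by linarith
    have slope: "\<bar>\<sigma> s\<bar> \<le> D / \<mu>" if "s \<in> {0..L}" for s
    proof -
      have g: "\<bar>\<beta>1 (\<rho> s) * (\<kappa> s - c0)\<^sup>2\<bar> \<le> B1 * N\<^sup>2" if "s \<in> {0..L}" for s
        using mult_mono[of "\<bar>\<beta>1 (\<rho> s)\<bar>" B1 "(\<kappa> s - c0)\<^sup>2" "N\<^sup>2"] N[OF that] beta_bounds(3)[OF that] const_nonneg
        by (simp add: abs_mult abs_le_square_iff[symmetric])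
      have "\<bar>\<sigma> s\<bar> \<le> 2 * (B1 * N\<^sup>2) * L / (2 * \<mu>)"
      proof (rule slope_bound[OF _ that])
        fix s t assume "s \<in> {0..L}" "t \<in> {0..L}"
        then show "\<bar>\<beta>1 (\<rho> s) * (\<kappa> s - c0)\<^sup>2 - \<beta>1 (\<rho> t) * (\<kappa> t - c0)\<^sup>2\<bar> \<le> 2 * (B1 * N\<^sup>2)"
          using g[of s] g[of t] by linarith
      qed
      then show ?thesis by (simp add: D_def)
    qed
    have eps: "D / \<mu> \<le> 1" using mu mu_pos by (simp add: \<mu>0_def)
    have "X \<le> \<mu>" using mu by (simp add: \<mu>0_def)
    then have X: "(P\<^sup>2 + 2 * L * (M * P + 2 * Q)) * (D / \<mu>) \<le> \<delta>"
      using mu_pos \<open>\<delta> > 0\<close> by (simp add: X_def field_simps)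
    have low: "\<delta> \<le> (\<kappa> s)\<^sup>2" if "s \<in> {0..L}" for s
      using curvature_lower[OF Lam N M slope eps P_def Q_def that] X by (simp add: \<delta>_def)
    have "Y < 2 * \<mu>" using mu unfolding \<mu>0_def by linarith
    then show "\<sigma> s = 0" "\<kappa> s = 2 * pi * of_int \<omega> / L"
      using constant_of_large_mu[OF \<open>\<delta> > 0\<close> low N M P_def R_def _ \<open>s \<in> {0..L}\<close>] by (auto simp: Y_def)
  qed
qed

section \<open>Reduction of a stationary solution of bounded energy to a rotated profile\<close>

lemma abs_diff_le_integral_abs:
  fixes f :: "real \<Rightarrow> real"
  assumes f: "\<And>s. s \<in> {a..b} \<Longrightarrow> (f has_real_derivative f' s) (at s within {a..b})"
    and cont: "continuous_on {a..b} f'" and xy: "x \<in> {a..b}" "y \<in> {a..b}"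
  shows "\<bar>f x - f y\<bar> \<le> integral {a..b} (\<lambda>s. \<bar>f' s\<bar>)"
proof -
  have *: "\<bar>f y - f x\<bar> \<le> integral {a..b} (\<lambda>s. \<bar>f' s\<bar>)" if xy: "x \<in> {a..b}" "y \<in> {a..b}" "x \<le> y" for x y
  proof -
    have c: "continuous_on {x..y} f'" using xy by (intro continuous_on_subset[OF cont]) auto
    have "(f' has_integral f y - f x) {x..y}"
      using xy by (intro has_integral_real_derivative DERIV_subset[OF f]) auto
    then have "\<bar>f y - f x\<bar> \<le> integral {x..y} (\<lambda>s. \<bar>f' s\<bar>)"
      using integral_norm_bound_integral[of f' "{x..y}" "\<lambda>s. \<bar>f' s\<bar>"] c
      by (auto simp: integral_unique intro!: integrable_continuous_real continuous_intros)
    also have "\<dots> \<le> integral {a..b} (\<lambda>s. \<bar>f' s\<bar>)"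
      using xy c cont by (intro integral_subset_le integrable_continuous_real continuous_intros) auto
    finally show ?thesis .
  qed
  show ?thesis using *[of x y] *[of y x] xy by (cases "x \<le> y") (auto simp: abs_minus_commute)
qed

text \<open>A negative radius is absorbed by a half turn. The sign matters: with
  \<open>lam \<ge> 0\<close> the angle pi, rather than 0, is the unstable equilibrium of the
  pendulum.\<close>

lemma polar_nonneg:
  fixes x y :: real
  obtains r a where "0 \<le> r" "x = r * cos a" "y = r * sin a"
proof -
  obtain r a where ra: "x = r * cos a" "y = r * sin a" using polar_Ex by blast
  show thesis
  proof (cases "0 \<le> r")
    case True
    then show thesis using that ra by blast
  next
    case False
    then show thesis using that[of "- r" "a + pi"] ra by simp
  qed
qed

text \<open>The multipliers are arbitrary real numbers rather than the nonlocal expressions, so the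
  limits of the multipliers along the flow can be inserted directly. The bound \<open>E\<close> is a
  parameter separate from \<mu>, which is how the uniformity of the initial energy is
  expressed.\<close>

locale stationary_solution =
  fixes L c0 \<nu> E \<mu> l1 l2 m :: real and \<omega> :: int
    and \<beta> \<beta>1 \<theta> \<kappa> \<kappa>1 \<rho> \<sigma> \<sigma>1 :: "real \<Rightarrow> real"
  assumes derivs: "\<And>s. s \<in> {0..L} \<Longrightarrow> (\<theta> has_real_derivative \<kappa> s) (at s within {0..L})"
      "\<And>s. s \<in> {0..L} \<Longrightarrow> (\<kappa> has_real_derivative \<kappa>1 s) (at s within {0..L})"
      "\<And>s. s \<in> {0..L} \<Longrightarrow> (\<rho> has_real_derivative \<sigma> s) (at s within {0..L})"
      "\<And>s. s \<in> {0..L} \<Longrightarrow> (\<sigma> has_real_derivative \<sigma>1 s) (at s within {0..L})"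
    and elastica: "\<And>s. s \<in> {0..L} \<Longrightarrow>
      \<beta> (\<rho> s) * \<kappa>1 s + \<beta>1 (\<rho> s) * \<sigma> s * (\<kappa> s - c0) = - l1 * sin (\<theta> s) + l2 * cos (\<theta> s)"
    and density: "\<And>s. s \<in> {0..L} \<Longrightarrow> \<mu> * \<sigma>1 s = \<beta>1 (\<rho> s) * (\<kappa> s - c0)\<^sup>2 / 2 + m"
    and ends: "\<theta> L - \<theta> 0 = 2 * pi * of_int \<omega>" "\<kappa> L = \<kappa> 0" "\<rho> L = \<rho> 0" "\<sigma> L = \<sigma> 0"
    and closed: "integral {0..L} (\<lambda>s. sin (\<theta> s)) = 0" "integral {0..L} (\<lambda>s. cos (\<theta> s)) = 0"
    and mass: "integral {0..L} \<rho> = \<nu> * L"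
    and energy: "integral {0..L} (\<lambda>s. \<beta> (\<rho> s) * (\<kappa> s - c0)\<^sup>2 / 2 + \<mu> / 2 * (\<sigma> s)\<^sup>2) \<le> E"

text \<open>The function \<beta> is only positive, possibly with infimum 0 and unbounded
  derivatives. For large \<mu> the gradient part of the energy keeps \<rho> in the compact interval
  \<open>I\<close> around \<nu>, and the constants of the profile locale are extrema of \<beta> and
  its derivatives on \<open>I\<close>; \<open>b\<close> is an attained minimum, hence
  positive.\<close>

theorem stationary_rigidity:
  fixes L c0 \<nu> E :: real and \<omega> :: int and \<beta> \<beta>1 \<beta>2 :: "real \<Rightarrow> real"
  assumes L: "0 < L" and omega: "\<omega> \<noteq> 0"
    and beta: "\<And>x. (\<beta> has_real_derivative \<beta>1 x) (at x)" "\<And>x. (\<beta>1 has_real_derivative \<beta>2 x) (at x)"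
      "continuous_on UNIV \<beta>2" and beta_pos: "\<And>x. 0 < \<beta> x"
  shows "\<exists>\<mu>0>0. \<forall>\<mu>\<ge>\<mu>0. \<forall>l1 l2 m \<theta> \<kappa> \<kappa>1 \<rho> \<sigma> \<sigma>1.
    stationary_solution L c0 \<nu> E \<mu> l1 l2 m \<omega> \<beta> \<beta>1 \<theta> \<kappa> \<kappa>1 \<rho> \<sigma> \<sigma>1 \<longrightarrow>
    (\<forall>s\<in>{0..L}. \<kappa> s = 2 * pi * of_int \<omega> / L \<and> \<rho> s = \<nu>)"
proof -
  have cont: "continuous_on {\<nu> - 1..\<nu> + 1} \<beta>" "continuous_on {\<nu> - 1..\<nu> + 1} \<beta>1" "continuous_on {\<nu> - 1..\<nu> + 1} \<beta>2"
    using beta by (auto intro: continuous_on_subset DERIV_continuous_on has_field_derivative_at_within)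
  define I where "I = {\<nu> - 1..\<nu> + 1}"
  have I: "compact I" "I \<noteq> {}" by (auto simp: I_def)
  obtain y where y: "y \<in> I" "\<And>x. x \<in> I \<Longrightarrow> \<beta> y \<le> \<beta> x"
    using continuous_attains_inf[OF I cont(1)[folded I_def]] by blast
  define b where "b = \<beta> y"
  have "0 < b" and b: "\<And>x. x \<in> I \<Longrightarrow> b \<le> \<beta> x"
    unfolding b_def by (rule beta_pos, rule y(2))
  have bdd: "\<exists>C. \<forall>x\<in>I. \<bar>f x\<bar> \<le> C" if "continuous_on I f" for f :: "real \<Rightarrow> real"
    using compact_imp_bounded[OF compact_continuous_image[OF that I(1)]] by (auto simp: bounded_iff)
  obtain B B1 B2 where B: "\<And>x. x \<in> I \<Longrightarrow> \<bar>\<beta> x\<bar> \<le> B" "\<And>x. x \<in> I \<Longrightarrow> \<bar>\<beta>1 x\<bar> \<le> B1"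
    "\<And>x. x \<in> I \<Longrightarrow> \<bar>\<beta>2 x\<bar> \<le> B2"
    using bdd[OF cont(1)[folded I_def]] bdd[OF cont(2)[folded I_def]] bdd[OF cont(3)[folded I_def]] by blast
  \<comment> \<open>From \<open>\<kappa>^2 \<le> 2 (\<kappa> - c0)^2 + 2 c0^2\<close> and
    \<open>b \<le> \<beta>(\<rho>)\<close>, the bending integral is at most \<open>4 / b\<close>
    times the bending energy plus \<open>2 c0^2 L\<close>.\<close>
  define K where "K = 4 * E / b + 2 * c0\<^sup>2 * L"
  obtain \<mu>1 where "\<mu>1 > 0" and \<mu>1: "\<forall>\<mu>\<ge>\<mu>1. \<forall>lam m \<theta> \<kappa> \<kappa>1 \<rho> \<sigma> \<sigma>1.
    stationary_profile L c0 \<mu> lam m b B B1 B2 K \<omega> \<beta> \<beta>1 \<beta>2 \<theta> \<kappa> \<kappa>1 \<rho> \<sigma> \<sigma>1 \<longrightarrow>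
    (\<forall>s\<in>{0..L}. \<sigma> s = 0 \<and> \<kappa> s = 2 * pi * of_int \<omega> / L)"
    using stationary_profile_large_mu[of L c0 b B B1 B2 K \<omega> \<beta> \<beta>1 \<beta>2] by (elim exE conjE)
  show ?thesis
  \<comment> \<open>The second summand yields \<open>2 E L \<le> \<mu>\<close>, exactly what
    confines \<rho> to within distance 1 of \<nu>.\<close>
  proof (intro exI[of _ "\<mu>1 + \<bar>2 * E * L\<bar>"] conjI allI impI ballI)
    show "0 < \<mu>1 + \<bar>2 * E * L\<bar>" using \<open>\<mu>1 > 0\<close> by simp
  next
    fix \<mu> l1 l2 m s0 :: real and \<theta> \<kappa> \<kappa>1 \<rho> \<sigma> \<sigma>1 :: "real \<Rightarrow> real"
    assume mu: "\<mu>1 + \<bar>2 * E * L\<bar> \<le> \<mu>" and s0: "s0 \<in> {0..L}"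
      and "stationary_solution L c0 \<nu> E \<mu> l1 l2 m \<omega> \<beta> \<beta>1 \<theta> \<kappa> \<kappa>1 \<rho> \<sigma> \<sigma>1"
    then interpret stationary_solution L c0 \<nu> E \<mu> l1 l2 m \<omega> \<beta> \<beta>1 \<theta> \<kappa> \<kappa>1 \<rho> \<sigma> \<sigma>1 by simp
    note d = derivs
    have "\<mu> > 0" "\<mu>1 \<le> \<mu>" "2 * E * L \<le> \<mu>" using mu \<open>\<mu>1 > 0\<close> by linarith+
    have c [continuous_intros]: "continuous_on {0..L} \<theta>" "continuous_on {0..L} \<kappa>" "continuous_on {0..L} \<rho>"
      "continuous_on {0..L} \<sigma>"
      using d by (meson DERIV_continuous_on)+
    have "continuous_on UNIV \<beta>" using beta(1) by (meson DERIV_continuous_on)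
    then have [continuous_intros]: "continuous_on {0..L} (\<lambda>s. \<beta> (\<rho> s))"
      by (auto intro: continuous_on_compose2 c)
    let ?Eb = "integral {0..L} (\<lambda>s. \<beta> (\<rho> s) * (\<kappa> s - c0)\<^sup>2 / 2)"
    let ?S2 = "integral {0..L} (\<lambda>s. (\<sigma> s)\<^sup>2)"
    have "integral {0..L} (\<lambda>s. \<beta> (\<rho> s) * (\<kappa> s - c0)\<^sup>2 / 2 + \<mu> / 2 * (\<sigma> s)\<^sup>2) = ?Eb + \<mu> / 2 * ?S2"
      by (subst integral_add) (auto intro!: integrable_continuous_real continuous_intros)
    moreover have "0 \<le> ?Eb" "0 \<le> ?S2"
      using beta_pos by (auto intro!: integral_nonneg integrable_continuous_real continuous_intros
          simp: less_imp_le)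
    ultimately have Eb: "?Eb \<le> E" and S2: "\<mu> * ?S2 \<le> 2 * E" and "0 \<le> E"
      using energy mult_nonneg_nonneg[of \<mu> ?S2] \<open>\<mu> > 0\<close> by linarith+
    \<comment> \<open>The prescribed mean \<nu> is attained, by the mean value theorem for the
      primitive of \<rho>.\<close>
    obtain t where t: "t \<in> {0..L}" "\<rho> t = \<nu>"
    proof -
      have "((\<lambda>s. integral {0..s} \<rho>) has_real_derivative \<rho> s) (at s within {0..L})" if "s \<in> {0..L}" for s
        using integral_has_real_derivative[OF c(3)] that by simp
      then obtain t where "t \<in> {0..L}" "integral {0..L} \<rho> - integral {0..0} \<rho> = \<rho> t * (L - 0)"
        using mean_value_Icc[of 0 L "\<lambda>s. integral {0..s} \<rho>" \<rho>] L by auto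
      then show thesis using that mass L by simp
    qed
    have rho_I: "\<rho> s \<in> I" if "s \<in> {0..L}" for s
    proof -
      \<comment> \<open>No pointwise bound on \<sigma> is available yet. The energy controls it in
        mean square only, so the oscillation of \<rho> is estimated through the integral of
        \<open>\<bar>\<sigma>\<bar>\<close> and Cauchy-Schwarz.\<close>
      have "\<bar>\<rho> s - \<nu>\<bar>\<^sup>2 \<le> (integral {0..L} (\<lambda>s. \<bar>\<sigma> s\<bar>))\<^sup>2"
        using abs_diff_le_integral_abs[OF d(3) c(4) that t(1)] t(2) by (intro power_mono) auto
      also have "\<dots> \<le> ?S2 * L"
        using Cauchy_Schwarz_integral_Icc[of 0 L "\<lambda>s. \<bar>\<sigma> s\<bar>" "\<lambda>s. 1"] L by (simp add: continuous_intros)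
      also have "\<dots> \<le> 1"
      proof -
        have "\<mu> * (?S2 * L) \<le> 2 * E * L" using mult_right_mono[OF S2, of L] L by (simp add: mult_ac)
        also have "\<dots> \<le> \<mu> * 1" using \<open>2 * E * L \<le> \<mu>\<close> by simp
        finally show ?thesis using \<open>\<mu> > 0\<close> by simp
      qed
      finally have "\<bar>\<rho> s - \<nu>\<bar> \<le> 1" by (simp add: abs_square_le_1)
      then show ?thesis by (auto simp: I_def abs_le_iff)
    qed
    have bending: "integral {0..L} (\<lambda>s. (\<kappa> s)\<^sup>2) \<le> K"
    proof -
      have I1: "((\<lambda>s. 4 / b * (\<beta> (\<rho> s) * (\<kappa> s - c0)\<^sup>2 / 2) + 2 * c0\<^sup>2) has_integral
          4 / b * ?Eb + 2 * c0\<^sup>2 * L) {0..L}"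
        using has_integral_const_real[of "2 * c0\<^sup>2" 0 L] L
        by (intro has_integral_mult_right has_integral_add integrable_integral
            integrable_continuous_real continuous_intros) (auto simp: mult.commute)
      have "((\<lambda>s. (\<kappa> s)\<^sup>2) has_integral integral {0..L} (\<lambda>s. (\<kappa> s)\<^sup>2)) {0..L}"
        by (intro integrable_integral integrable_continuous_real continuous_intros)
      from this I1 have "integral {0..L} (\<lambda>s. (\<kappa> s)\<^sup>2) \<le> 4 / b * ?Eb + 2 * c0\<^sup>2 * L"
      proof (rule has_integral_le)
        fix s assume s: "s \<in> {0..L}"
        have "2 * (\<kappa> s - c0)\<^sup>2 + 2 * c0\<^sup>2 - (\<kappa> s)\<^sup>2 = (\<kappa> s - 2 * c0)\<^sup>2"
          by (simp add: power2_eq_square algebra_simps)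
        then have "(\<kappa> s)\<^sup>2 \<le> 2 * (\<kappa> s - c0)\<^sup>2 + 2 * c0\<^sup>2"
          using zero_le_power2[of "\<kappa> s - 2 * c0"] by linarith
        moreover have "b * (\<kappa> s - c0)\<^sup>2 \<le> \<beta> (\<rho> s) * (\<kappa> s - c0)\<^sup>2"
          using b[OF rho_I[OF s]] by (intro mult_right_mono) auto
        then have "2 * (\<kappa> s - c0)\<^sup>2 \<le> 4 / b * (\<beta> (\<rho> s) * (\<kappa> s - c0)\<^sup>2 / 2)"
          using \<open>0 < b\<close> by (simp add: field_simps)
        ultimately show "(\<kappa> s)\<^sup>2 \<le> 4 / b * (\<beta> (\<rho> s) * (\<kappa> s - c0)\<^sup>2 / 2) + 2 * c0\<^sup>2" by linarith
      qed
      also have "4 / b * ?Eb \<le> 4 / b * E" using Eb \<open>0 < b\<close> by (intro mult_left_mono) auto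
      finally show ?thesis by (simp add: K_def)
    qed
    \<comment> \<open>Polar coordinates of the multiplier vector: \<open>l1 sin \<theta> - l2 cos
      \<theta> = lam sin (\<theta> - \<phi>)\<close>. Rotating the curve by \<open>- \<phi>\<close>
      preserves curvature, winding and closedness.\<close>
    obtain lam \<phi> where lam: "0 \<le> lam" "l1 = lam * cos \<phi>" "l2 = lam * sin \<phi>"
      using polar_nonneg[of l1 l2] by metis
    have "stationary_profile L c0 \<mu> lam m b B B1 B2 K \<omega> \<beta> \<beta>1 \<beta>2 (\<lambda>s. \<theta> s - \<phi>) \<kappa> \<kappa>1 \<rho> \<sigma> \<sigma>1"
    proof
      show "\<beta> (\<rho> s) \<le> B" "\<bar>\<beta>1 (\<rho> s)\<bar> \<le> B1" "\<bar>\<beta>2 (\<rho> s)\<bar> \<le> B2" "b \<le> \<beta> (\<rho> s)" if "s \<in> {0..L}" for s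
        using b[OF rho_I[OF that]] B[OF rho_I[OF that]] by auto
      show "((\<lambda>s. \<theta> s - \<phi>) has_real_derivative \<kappa> s) (at s within {0..L})" if "s \<in> {0..L}" for s
        using DERIV_diff[OF d(1)[OF that] DERIV_const[of \<phi>]] by simp
      show "\<beta> (\<rho> s) * \<kappa>1 s + \<beta>1 (\<rho> s) * \<sigma> s * (\<kappa> s - c0) = - lam * sin (\<theta> s - \<phi>)" if "s \<in> {0..L}" for s
        using elastica[OF that] lam by (simp add: sin_diff algebra_simps)
      have "integral {0..L} (\<lambda>s. cos (\<theta> s - \<phi>)) =
          integral {0..L} (\<lambda>s. cos (\<theta> s) * cos \<phi>) + integral {0..L} (\<lambda>s. sin (\<theta> s) * sin \<phi>)"
        unfolding cos_diff by (intro integral_add integrable_continuous_real continuous_intros)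
      then show "integral {0..L} (\<lambda>s. cos (\<theta> s - \<phi>)) = 0" using closed by simp
    qed (use d density ends bending beta omega lam L \<open>0 < b\<close> \<open>\<mu> > 0\<close> in auto)
    then have *: "\<sigma> s = 0" "\<kappa> s = 2 * pi * of_int \<omega> / L" if "s \<in> {0..L}" for s
      using \<mu>1[rule_format, OF \<open>\<mu>1 \<le> \<mu>\<close> _ that] by auto
    have "\<bar>\<rho> s0 - \<rho> t\<bar> \<le> 0 * (L - 0)"
      using * by (intro derivative_bound_Icc[OF d(3) _ s0 t(1)]) auto
    then show "\<kappa> s0 = 2 * pi * of_int \<omega> / L" "\<rho> s0 = \<nu>" using *[OF s0] t(2) by simp_all
  qed
qed

section \<open>Derivatives and limits of functions of space and time\<close>

lemma ds_eq:
  assumes "0 < L" "s \<in> {0..L}" "(f has_real_derivative D) (at s within {0..L})"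
  shows "ds L f s = D"
  using assms unfolding ds_def
  by (intro vector_derivative_within_closed_interval)
     (auto simp: has_real_derivative_iff_has_vector_derivative[symmetric])

lemma differentiable_imp_ds:
  assumes "f differentiable (at s within {0..L})"
  shows "(f has_real_derivative ds L f s) (at s within {0..L})"
  using assms unfolding ds_def has_real_derivative_iff_has_vector_derivative
  by (simp add: vector_derivative_works)

lemma dt_eq:
  assumes "((\<lambda>\<tau>. u \<tau> s) has_real_derivative D) (at t)"
  shows "dt u t s = D"
  using assms unfolding dt_def by (intro vector_derivative_at)
    (auto simp: has_real_derivative_iff_has_vector_derivative[symmetric])

lemma C2_on_interval_derivs:
  assumes "C2_on_interval L f"
  shows "s \<in> {0..L} \<Longrightarrow> (f has_real_derivative ds L f s) (at s within {0..L})"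
    and "s \<in> {0..L} \<Longrightarrow> (ds L f has_real_derivative ds L (ds L f) s) (at s within {0..L})"
    and "continuous_on {0..L} f" "continuous_on {0..L} (ds L f)"
proof -
  have *: "\<forall>k<2. \<forall>s\<in>{0..L}. (ds L ^^ k) f differentiable (at s within {0..L})"
    using assms by (simp add: C2_on_interval_def)
  show 1: "(f has_real_derivative ds L f s) (at s within {0..L})" if "s \<in> {0..L}" for s
    using *[rule_format, of 0 s] that by (simp add: differentiable_imp_ds)
  show 2: "(ds L f has_real_derivative ds L (ds L f) s) (at s within {0..L})" if "s \<in> {0..L}" for s
    using *[rule_format, of 1 s] that by (simp add: differentiable_imp_ds)
  show "continuous_on {0..L} f" "continuous_on {0..L} (ds L f)"
    using 1 2 by (meson DERIV_continuous_on)+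
qed

lemma smooth_spacetime_Suc: "smooth_spacetime L u \<Longrightarrow> Ck_spacetime (Suc k) L u"
  unfolding smooth_spacetime_def by blast

lemma smooth_spacetime_dt: "smooth_spacetime L u \<Longrightarrow> smooth_spacetime L (dt u)"
  and smooth_spacetime_ds: "smooth_spacetime L u \<Longrightarrow> smooth_spacetime L (\<lambda>t. ds L (u t))"
  unfolding smooth_spacetime_def[of L "dt u"] smooth_spacetime_def[of L "\<lambda>t. ds L (u t)"]
  by (auto dest: smooth_spacetime_Suc)

lemma smooth_spacetime_continuous:
  "smooth_spacetime L u \<Longrightarrow> continuous_on ({0<..} \<times> {0..L}) (\<lambda>(t, s). u t s)"
  unfolding smooth_spacetime_def by (metis Ck_spacetime.simps(1))

lemma smooth_spacetime_derivs:
  assumes "smooth_spacetime L u" "0 < t" "s \<in> {0..L}"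
  shows "((\<lambda>\<tau>. u \<tau> s) has_real_derivative dt u t s) (at t)"
    and "(u t has_real_derivative ds L (u t) s) (at s within {0..L})"
proof -
  have "Ck_spacetime (Suc 0) L u" by (rule smooth_spacetime_Suc[OF assms(1)])
  then have "(\<lambda>\<tau>. u \<tau> s) differentiable (at t)" "u t differentiable (at s within {0..L})"
    using assms(2,3) by auto
  then show "((\<lambda>\<tau>. u \<tau> s) has_real_derivative dt u t s) (at t)"
    by (simp add: dt_def has_real_derivative_iff_has_vector_derivative vector_derivative_works)
  show "(u t has_real_derivative ds L (u t) s) (at s within {0..L})"
    by (rule differentiable_imp_ds) fact
qed

lemma smooth_spacetime_continuous_slice:
  assumes "smooth_spacetime L u" "0 < t"
  shows "continuous_on {0..L} (u t)"
  by (rule DERIV_continuous_on) (rule smooth_spacetime_derivs(2)[OF assms])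

lemma leibniz_Icc:
  fixes f f' :: "real \<Rightarrow> real \<Rightarrow> real"
  assumes "\<And>t s. 0 < t \<Longrightarrow> s \<in> {a..b} \<Longrightarrow> ((\<lambda>\<tau>. f \<tau> s) has_real_derivative f' t s) (at t)"
    and "\<And>t. 0 < t \<Longrightarrow> continuous_on {a..b} (f t)"
    and "continuous_on ({0<..} \<times> {a..b}) (\<lambda>(t, s). f' t s)" "0 < t"
  shows "((\<lambda>\<tau>. integral {a..b} (f \<tau>)) has_real_derivative integral {a..b} (f' t)) (at t)"
proof -
  have "((\<lambda>\<tau>. integral (cbox a b) (f \<tau>)) has_real_derivative integral (cbox a b) (f' t)) (at t within {0<..})"
  proof (rule leibniz_rule_field_derivative)
    show "((\<lambda>\<tau>. f \<tau> s) has_real_derivative f' t s) (at t within {0<..})"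
      if "t \<in> {0<..}" "s \<in> cbox a b" for t s
      using assms(1)[of t s] that by (simp add: has_field_derivative_at_within)
    show "f t integrable_on cbox a b" if "t \<in> {0<..}" for t
      using assms(2)[of t] that by (simp add: integrable_continuous_real)
  qed (use assms(3,4) in auto)
  then show ?thesis using assms(4) at_within_open[of t "{0<..}"] by simp
qed

text \<open>At the end points of \<open>[0,L]\<close> the derivative in \<open>s\<close> is
  one-sided, so the interchange goes through integrals: \<open>u t r - u t 0\<close> is the integral
  of the \<open>s\<close>-derivative, which is differentiated in time under the integral sign and
  then in \<open>r\<close>.\<close>

lemma mixed_derivative:
  assumes u: "smooth_spacetime L u" and "0 < L" "0 < t" "s \<in> {0..L}"
  shows "ds L (dt u t) s = dt (\<lambda>t. ds L (u t)) t s"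
proof -
  define v where "v t = ds L (u t)" for t
  have v: "smooth_spacetime L v" unfolding v_def by (rule smooth_spacetime_ds[OF u])
  have eq: "dt u t r = dt u t 0 + integral {0..r} (dt v t)" if r: "r \<in> {0..L}" for r
  proof -
    have I: "((\<lambda>\<tau>. integral {0..r} (v \<tau>)) has_real_derivative integral {0..r} (dt v t)) (at t)"
    proof (rule leibniz_Icc)
      show "continuous_on {0..r} (v t)" if "0 < t" for t
        using r by (intro continuous_on_subset[OF smooth_spacetime_continuous_slice[OF v that]]) auto
      show "continuous_on ({0<..} \<times> {0..r}) (\<lambda>(t, s). dt v t s)"
        using r by (intro continuous_on_subset[OF smooth_spacetime_continuous[OF smooth_spacetime_dt[OF v]]]) auto
      show "((\<lambda>\<tau>. v \<tau> s) has_real_derivative dt v t s) (at t)" if "0 < t" "s \<in> {0..r}" for t s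
        by (rule smooth_spacetime_derivs(1)[OF v that(1)]) (use that r in auto)
    qed (rule \<open>0 < t\<close>)
    have J: "integral {0..r} (v \<tau>) = u \<tau> r - u \<tau> 0" if "0 < \<tau>" for \<tau>
    proof -
      have "(u \<tau> has_real_derivative v \<tau> x) (at x within {0..r})" if "x \<in> {0..r}" for x
        by (rule DERIV_subset[OF smooth_spacetime_derivs(2)[OF u \<open>0 < \<tau>\<close>, folded v_def]])
           (use that r in auto)
      then have "(v \<tau> has_integral u \<tau> r - u \<tau> 0) {0..r}"
        using r by (intro has_integral_real_derivative) auto
      then show ?thesis by (rule integral_unique)
    qed
    have "((\<lambda>\<tau>. u \<tau> r - u \<tau> 0) has_real_derivative integral {0..r} (dt v t)) (at t)"
      by (rule has_field_derivative_transform_within_open[OF I open_greaterThan[of 0]])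
         (simp_all only: greaterThan_iff J \<open>0 < t\<close>)
    moreover have "((\<lambda>\<tau>. u \<tau> r - u \<tau> 0) has_real_derivative dt u t r - dt u t 0) (at t)"
      using r \<open>0 < L\<close> by (intro DERIV_diff smooth_spacetime_derivs(1)[OF u \<open>0 < t\<close>]) auto
    ultimately have "integral {0..r} (dt v t) = dt u t r - dt u t 0" by (rule DERIV_unique)
    then show ?thesis by simp
  qed
  have "((\<lambda>r. integral {0..r} (dt v t)) has_real_derivative dt v t s) (at s within {0..L})"
    by (rule integral_has_real_derivative[OF
        smooth_spacetime_continuous_slice[OF smooth_spacetime_dt[OF v] \<open>0 < t\<close>] assms(4)])
  from DERIV_add[OF DERIV_const[of "dt u t 0"] this]
  have "((\<lambda>r. dt u t 0 + integral {0..r} (dt v t)) has_real_derivative dt v t s) (at s within {0..L})"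
    by simp
  then have "(dt u t has_real_derivative dt v t s) (at s within {0..L})"
    by (rule has_field_derivative_transform_within[OF _ zero_less_one assms(4)]) (rule eq[symmetric])
  then have "ds L (dt u t) s = dt v t s" by (rule ds_eq[OF \<open>0 < L\<close> assms(4)])
  moreover have "v = (\<lambda>t. ds L (u t))" by (simp add: fun_eq_iff v_def)
  ultimately show ?thesis by simp
qed

section \<open>Uniform limits, and convergence of integrals along a solution\<close>

lemma uniform_limit_Pair:
  assumes "uniform_limit S f f' F" "uniform_limit S g g' F"
  shows "uniform_limit S (\<lambda>t s. (f t s, g t s)) (\<lambda>s. (f' s, g' s)) F"
proof (rule uniform_limitI)
  fix e :: real assume "0 < e"
  then have "\<forall>\<^sub>F t in F. \<forall>s\<in>S. dist (f t s) (f' s) < e / 2" "\<forall>\<^sub>F t in F. \<forall>s\<in>S. dist (g t s) (g' s) < e / 2"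
    using uniform_limitD[OF assms(1), of "e / 2"] uniform_limitD[OF assms(2), of "e / 2"] by simp_all
  then show "\<forall>\<^sub>F t in F. \<forall>s\<in>S. dist (f t s, g t s) (f' s, g' s) < e"
  proof eventually_elim
    case (elim t)
    show ?case
    proof
      fix s assume "s \<in> S"
      have "dist (f t s, g t s) (f' s, g' s) \<le> dist (f t s) (f' s) + dist (g t s) (g' s)"
        unfolding dist_Pair_Pair by (rule sqrt_sum_squares_le_sum) auto
      also have "\<dots> < e" using elim \<open>s \<in> S\<close> by fastforce
      finally show "dist (f t s, g t s) (f' s, g' s) < e" .
    qed
  qed
qed

text \<open>Since the limit is bounded, the values eventually stay in one closed ball, which is
  compact, and \<Phi> is uniformly continuous there.\<close>

lemma uniform_limit_compose_continuous:
  fixes f :: "'t \<Rightarrow> 's \<Rightarrow> 'a :: heine_borel" and \<Phi> :: "'a \<Rightarrow> 'b :: metric_space"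
  assumes f: "uniform_limit S f g F" and "bounded (g ` S)" and \<Phi>: "continuous_on UNIV \<Phi>"
  shows "uniform_limit S (\<lambda>t s. \<Phi> (f t s)) (\<lambda>s. \<Phi> (g s)) F"
proof -
  obtain x R where R: "\<And>s. s \<in> S \<Longrightarrow> dist x (g s) \<le> R"
    using assms(2) by (auto simp: bounded_def)
  have "\<forall>\<^sub>F t in F. \<forall>s\<in>S. dist (f t s) (g s) < 1"
    using f by (rule uniform_limitD) simp
  then have "\<forall>\<^sub>F t in F. \<forall>s\<in>S. f t s \<in> cball x (R + 1)"
  proof eventually_elim
    case (elim t)
    show ?case
    proof
      fix s assume s: "s \<in> S"
      have "dist x (f t s) \<le> dist x (g s) + dist (g s) (f t s)" by (rule dist_triangle)
      also have "\<dots> \<le> R + 1" using R[OF s] elim s by (auto simp: dist_commute intro!: add_mono less_imp_le)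
      finally show "f t s \<in> cball x (R + 1)" by simp
    qed
  qed
  moreover have "uniformly_continuous_on (cball x (R + 1)) \<Phi>"
    by (rule compact_uniformly_continuous[OF continuous_on_subset[OF \<Phi>]]) auto
  ultimately show ?thesis
    by (intro uniform_limit_compose_uniformly_continuous_on[OF f]) auto
qed

lemma uniform_limit_integral_Icc:
  fixes f :: "'t \<Rightarrow> real \<Rightarrow> real"
  assumes "uniform_limit {a..b} f g F" "a \<le> b"
    and "\<forall>\<^sub>F t in F. continuous_on {a..b} (f t)" "continuous_on {a..b} g"
  shows "((\<lambda>t. integral {a..b} (f t)) \<longlongrightarrow> integral {a..b} g) F"
proof (rule tendstoI)
  fix e :: real assume "0 < e"
  define d where "d = e / (b - a + 1)"
  have "d > 0" using \<open>0 < e\<close> assms(2) by (simp add: d_def)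
  then have "\<forall>\<^sub>F t in F. \<forall>s\<in>{a..b}. dist (f t s) (g s) < d"
    by (rule uniform_limitD[OF assms(1)])
  then show "\<forall>\<^sub>F t in F. dist (integral {a..b} (f t)) (integral {a..b} g) < e"
    using assms(3)
  proof eventually_elim
    case (elim t)
    have I: "(\<lambda>s. f t s - g s) integrable_on {a..b}"
      using elim assms(4) by (intro integrable_continuous_real continuous_intros)
    have "integral {a..b} (f t) - integral {a..b} g = integral {a..b} (\<lambda>s. f t s - g s)"
      using elim assms(4) by (intro integral_diff[symmetric] integrable_continuous_real)
    also have "norm \<dots> \<le> integral {a..b} (\<lambda>s. d)"
      using elim I by (intro integral_norm_bound_integral) (auto simp: dist_real_def less_imp_le)
    also have "\<dots> = d * (b - a)" using assms(2) by simp
    also have "\<dots> < d * (b - a + 1)" using \<open>d > 0\<close> by (simp add: algebra_simps)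
    also have "\<dots> = e" using assms(2) by (simp add: d_def)
    finally show ?case by (simp add: dist_real_def)
  qed
qed

lemma C2_tendsto_imp_tendsto:
  assumes "C2_tendsto L u g F" "s \<in> {0..L}"
  shows "((\<lambda>t. u t s) \<longlongrightarrow> g s) F" "((\<lambda>t. ds L (u t) s) \<longlongrightarrow> ds L g s) F"
    "((\<lambda>t. ds L (ds L (u t)) s) \<longlongrightarrow> ds L (ds L g) s) F"
proof -
  have *: "uniform_limit {0..L} (\<lambda>t. (ds L ^^ k) (u t)) ((ds L ^^ k) g) F" if "k \<le> 2" for k
    using assms(1) that by (simp add: C2_tendsto_def)
  show "((\<lambda>t. u t s) \<longlongrightarrow> g s) F" "((\<lambda>t. ds L (u t) s) \<longlongrightarrow> ds L g s) F"
    "((\<lambda>t. ds L (ds L (u t)) s) \<longlongrightarrow> ds L (ds L g) s) F"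
    using tendsto_uniform_limitI[OF *[of 0] assms(2)] tendsto_uniform_limitI[OF *[of 1] assms(2)]
      tendsto_uniform_limitI[OF *[of 2] assms(2)]
    by (simp_all add: numeral_2_eq_2)
qed

text \<open>The energy, the constraints, the entries of the matrix and the integrals in the
  multipliers all have the form of an integral of a continuous function of the values and first
  derivatives of \<theta> and \<rho>. Bundling these four numbers lets one convergence result serve
  all of them.\<close>

definition jet :: "real \<Rightarrow> (real \<Rightarrow> real) \<Rightarrow> (real \<Rightarrow> real) \<Rightarrow> real \<Rightarrow> (real \<times> real) \<times> real \<times> real" where
  "jet L \<theta> \<rho> s = ((\<theta> s, ds L \<theta> s), (\<rho> s, ds L \<rho> s))"

lemma jet_integral_tendsto:
  fixes \<Phi> :: "(real \<times> real) \<times> real \<times> real \<Rightarrow> real"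
  assumes \<theta>: "C2_tendsto L \<theta> g F" and \<rho>: "C2_tendsto L \<rho> h F" and \<Phi>: "continuous_on UNIV \<Phi>" and "0 \<le> L"
  shows "((\<lambda>t. integral {0..L} (\<lambda>s. \<Phi> (jet L (\<theta> t) (\<rho> t) s))) \<longlongrightarrow> integral {0..L} (\<lambda>s. \<Phi> (jet L g h s))) F"
proof -
  have lim: "uniform_limit {0..L} u v F \<and> uniform_limit {0..L} (\<lambda>t. ds L (u t)) (ds L v) F"
    if "C2_tendsto L u v F" for u :: "'a \<Rightarrow> real \<Rightarrow> real" and v
  proof -
    have "uniform_limit {0..L} (\<lambda>t. (ds L ^^ k) (u t)) ((ds L ^^ k) v) F" if "k \<le> 2" for k
      using \<open>C2_tendsto L u v F\<close> that by (simp add: C2_tendsto_def)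
    from this[of 0] this[of 1] show ?thesis by simp
  qed
  have cont: "continuous_on {0..L} (jet L u v)" if "C2_on_interval L u" "C2_on_interval L v" for u v
    unfolding jet_def using C2_on_interval_derivs(3,4)[OF that(1)] C2_on_interval_derivs(3,4)[OF that(2)]
    by (intro continuous_intros)
  have C2: "C2_on_interval L g" "C2_on_interval L h"
    using \<theta> \<rho> by (auto simp: C2_tendsto_def)
  have "uniform_limit {0..L} (\<lambda>t. jet L (\<theta> t) (\<rho> t)) (jet L g h) F"
    unfolding jet_def using lim[OF \<theta>] lim[OF \<rho>] by (intro uniform_limit_Pair) auto
  then have unif: "uniform_limit {0..L} (\<lambda>t s. \<Phi> (jet L (\<theta> t) (\<rho> t) s)) (\<lambda>s. \<Phi> (jet L g h s)) F"
    by (rule uniform_limit_compose_continuous[OF _ compact_imp_bounded[OF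
        compact_continuous_image[OF cont[OF C2] compact_Icc]] \<Phi>])
  have \<Phi>_cont: "continuous_on {0..L} (\<lambda>s. \<Phi> (jet L u v s))" if "C2_on_interval L u" "C2_on_interval L v" for u v
    by (rule continuous_on_compose2[OF \<Phi> cont[OF that]]) simp
  have "\<forall>\<^sub>F t in F. C2_on_interval L (\<theta> t)" "\<forall>\<^sub>F t in F. C2_on_interval L (\<rho> t)"
    using \<theta> \<rho> by (auto simp: C2_tendsto_def)
  then have "\<forall>\<^sub>F t in F. continuous_on {0..L} (\<lambda>s. \<Phi> (jet L (\<theta> t) (\<rho> t) s))"
    by eventually_elim (rule \<Phi>_cont)
  then show ?thesis
    by (rule uniform_limit_integral_Icc[OF unif \<open>0 \<le> L\<close> _ \<Phi>_cont[OF C2]])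
qed

text \<open>The flow is differentiable in time only for \<open>t > 0\<close>; the initial value
  therefore enters as a right-hand limit, supplied by continuity into C^2.\<close>

lemma limits_of_nonincreasing:
  fixes f :: "real \<Rightarrow> real"
  assumes "\<And>t. 0 < t \<Longrightarrow> (f has_real_derivative f' t) (at t)" "\<And>t. 0 < t \<Longrightarrow> f' t \<le> 0"
    and "(f \<longlongrightarrow> x) (at_right 0)" "(f \<longlongrightarrow> y) at_top"
  shows "y \<le> x"
proof -
  have mono: "f t \<le> f s" if "0 < s" "s \<le> t" for s t
  proof (rule DERIV_nonpos_imp_nonincreasing[OF that(2)])
    fix x assume "s \<le> x" "x \<le> t"
    then show "\<exists>y. (f has_real_derivative y) (at x) \<and> y \<le> 0"
      using assms(1,2)[of x] \<open>0 < s\<close> by auto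
  qed
  have "y \<le> f s" if "0 < s" for s
    using that assms(4) by (intro tendsto_upperbound[of f y at_top])
      (auto intro: eventually_mono[OF eventually_ge_at_top[of s]] mono)
  then show ?thesis
    using assms(3) by (intro tendsto_lowerbound[of f x "at_right 0"])
      (auto intro: eventually_mono[OF eventually_at_right_less])
qed

lemma limits_of_constant:
  fixes f :: "real \<Rightarrow> real"
  assumes "\<And>t. 0 < t \<Longrightarrow> (f has_real_derivative 0) (at t)"
    and "(f \<longlongrightarrow> x) (at_right 0)" "(f \<longlongrightarrow> y) at_top"
  shows "y = x"
proof (rule antisym)
  show "y \<le> x" by (rule limits_of_nonincreasing[of f "\<lambda>_. 0"]) (use assms in auto)
  have "- y \<le> - x"
    by (rule limits_of_nonincreasing[of "\<lambda>t. - f t" "\<lambda>_. 0"])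
       (use assms in \<open>auto intro!: derivative_eq_intros tendsto_minus\<close>)
  then show "x \<le> y" by simp
qed

text \<open>The increments \<open>f (t + 1) - f t\<close> tend to 0, but by the mean value theorem
  they are values of \<open>f'\<close> at late times, which are close to \<open>c\<close>.\<close>

lemma limit_of_derivative_zero:
  fixes f :: "real \<Rightarrow> real"
  assumes f: "\<And>t. 0 < t \<Longrightarrow> (f has_real_derivative f' t) (at t)"
    and "(f \<longlongrightarrow> y) at_top" "(f' \<longlongrightarrow> c) at_top"
  shows "c = 0"
proof (rule ccontr)
  assume "c \<noteq> 0"
  then have "\<forall>\<^sub>F t in at_top. dist (f' t) c < \<bar>c\<bar> / 2"
    using assms(3) by (intro tendstoD) auto
  then obtain T where T: "\<And>t. T \<le> t \<Longrightarrow> dist (f' t) c < \<bar>c\<bar> / 2"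
    by (auto simp: eventually_at_top_linorder)
  have shift: "((\<lambda>t. f (t + 1)) \<longlongrightarrow> y) at_top"
    by (rule filterlim_compose[OF assms(2)]) (rule filterlim_tendsto_add_at_top[OF tendsto_const filterlim_ident, of 1, simplified add.commute])
  have "((\<lambda>t. f (t + 1) - f t) \<longlongrightarrow> y - y) at_top"
    by (rule tendsto_diff[OF shift assms(2)])
  then have "\<forall>\<^sub>F t in at_top. dist (f (t + 1) - f t) 0 < \<bar>c\<bar> / 2"
    using \<open>c \<noteq> 0\<close> by (intro tendstoD) auto
  then have "\<forall>\<^sub>F t in at_top. max T 1 \<le> t \<and> dist (f (t + 1) - f t) 0 < \<bar>c\<bar> / 2"
    using eventually_ge_at_top[of "max T 1"] by eventually_elim auto
  then obtain t where t: "max T 1 \<le> t" "dist (f (t + 1) - f t) 0 < \<bar>c\<bar> / 2"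
    by (auto simp: eventually_at_top_linorder)
  obtain z where "t < z" "z < t + 1" "f (t + 1) - f t = f' z"
    using MVT2[of t "t + 1" f f'] f t(1) by auto
  then show False using t T[of z] by (auto simp: dist_real_def abs_if split: if_splits)
qed

text \<open>
  Strict Cauchy-Schwarz: \<open>cos \<theta>\<close> and \<open>sin \<theta>\<close> are linearly independent, since \<open>\<theta>\<close> attains all directions.
\<close>

lemma Pi_determinant_pos:
  fixes L :: real and \<theta> :: "real \<Rightarrow> real"
  assumes "0 < L" and cont [continuous_intros]: "continuous_on {0..L} \<theta>"
    and wind: "\<theta> L - \<theta> 0 = 2 * pi * of_int \<omega>" "\<omega> \<noteq> 0"
  shows "0 < integral {0..L} (\<lambda>s. (sin (\<theta> s))\<^sup>2) * integral {0..L} (\<lambda>s. (cos (\<theta> s))\<^sup>2)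
    - (integral {0..L} (\<lambda>s. cos (\<theta> s) * sin (\<theta> s)))\<^sup>2"
proof -
  define S C M where "S = integral {0..L} (\<lambda>s. (sin (\<theta> s))\<^sup>2)"
    and "C = integral {0..L} (\<lambda>s. (cos (\<theta> s))\<^sup>2)" and "M = integral {0..L} (\<lambda>s. cos (\<theta> s) * sin (\<theta> s))"
  have I: "((\<lambda>s. (sin (\<theta> s))\<^sup>2) has_integral S) {0..L}" "((\<lambda>s. (cos (\<theta> s))\<^sup>2) has_integral C) {0..L}"
    "((\<lambda>s. cos (\<theta> s) * sin (\<theta> s)) has_integral M) {0..L}"
    unfolding S_def C_def M_def
    by (intro integrable_integral integrable_continuous_real continuous_intros)+
  have pos: "0 < integral {0..L} f" if "continuous_on {0..L} f" "\<And>s. 0 \<le> f s" "s \<in> {0..L}" "f s \<noteq> 0"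
    for f :: "real \<Rightarrow> real" and s
    using integral_eq_0_iff[OF that(1) \<open>0 < L\<close> that(2)] that(3,4)
      integral_nonneg[OF integrable_continuous_real[OF that(1)] that(2)] by fastforce
  obtain s and k :: int where s: "s \<in> {0..L}" "\<theta> s = 0 + 2 * pi * of_int k"
    using winding_attains_angle[OF _ cont wind] \<open>0 < L\<close> by (metis less_imp_le)
  obtain r and j :: int where r: "r \<in> {0..L}" "\<theta> r = pi / 2 + 2 * pi * of_int j"
    using winding_attains_angle[OF _ cont wind] \<open>0 < L\<close> by (metis less_imp_le)
  have "C > 0" unfolding C_def
    by (rule pos[OF _ _ s(1)]) (auto intro!: continuous_intros simp: s(2) cos_int_2pin)
  have "sin (\<theta> r) = 1" "cos (\<theta> r) = 0"
    unfolding r(2) by (simp_all add: sin_add cos_add sin_int_2pin cos_int_2pin)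
  \<comment> \<open>Where \<theta> is \<open>pi / 2\<close> modulo a full turn, the integrand equals
    \<open>C^2 > 0\<close>; expanding the square turns the integral into \<open>C\<close> times the
    determinant.\<close>
  then have "0 < integral {0..L} (\<lambda>s. (C * sin (\<theta> s) - M * cos (\<theta> s))\<^sup>2)"
    using \<open>C > 0\<close> by (intro pos[OF _ _ r(1)]) (auto intro!: continuous_intros)
  moreover have "((\<lambda>s. C\<^sup>2 * (sin (\<theta> s))\<^sup>2 - 2 * C * M * (cos (\<theta> s) * sin (\<theta> s)) + M\<^sup>2 * (cos (\<theta> s))\<^sup>2)
      has_integral C\<^sup>2 * S - 2 * C * M * M + M\<^sup>2 * C) {0..L}"
    by (intro has_integral_add has_integral_diff has_integral_mult_right I)
  then have "integral {0..L} (\<lambda>s. (C * sin (\<theta> s) - M * cos (\<theta> s))\<^sup>2) = C\<^sup>2 * S - 2 * C * M * M + M\<^sup>2 * C"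
    by (intro integral_unique, elim has_integral_eq[rotated]) (simp add: power2_eq_square algebra_simps)
  ultimately have "0 < C * (S * C - M\<^sup>2)" by (simp add: power2_eq_square algebra_simps)
  then show ?thesis using \<open>C > 0\<close> unfolding S_def C_def M_def by (simp add: zero_less_mult_iff)
qed

text \<open>\<open>matrix_inv\<close> is a choice of a two-sided inverse, meaningful here because
  the determinant \<open>S * C - M^2\<close> is nonzero. The quotient formulas serve the convergence
  of the multipliers; the linear system is what makes the velocity orthogonal to the
  constraints.\<close>

lemma lambda_theta_Cramer:
  fixes L c0 \<beta> \<theta> \<rho>
  defines "S \<equiv> integral {0..L} (\<lambda>s. (sin (\<theta> s))\<^sup>2)"
    and "C \<equiv> integral {0..L} (\<lambda>s. (cos (\<theta> s))\<^sup>2)"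
    and "M \<equiv> integral {0..L} (\<lambda>s. cos (\<theta> s) * sin (\<theta> s))"
    and "v1 \<equiv> integral {0..L} (\<lambda>s. cos (\<theta> s) * ds L \<theta> s * \<beta> (\<rho> s) * (ds L \<theta> s - c0))"
    and "v2 \<equiv> integral {0..L} (\<lambda>s. sin (\<theta> s) * ds L \<theta> s * \<beta> (\<rho> s) * (ds L \<theta> s - c0))"
  assumes D: "S * C - M\<^sup>2 \<noteq> 0"
  shows "lambda_theta L c0 \<beta> \<theta> \<rho> $ 1 = (C * v1 + M * v2) / (S * C - M\<^sup>2)"
    and "lambda_theta L c0 \<beta> \<theta> \<rho> $ 2 = (M * v1 + S * v2) / (S * C - M\<^sup>2)"
    and "S * lambda_theta L c0 \<beta> \<theta> \<rho> $ 1 - M * lambda_theta L c0 \<beta> \<theta> \<rho> $ 2 = v1"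
    and "- M * lambda_theta L c0 \<beta> \<theta> \<rho> $ 1 + C * lambda_theta L c0 \<beta> \<theta> \<rho> $ 2 = v2"
proof -
  define A where "A = Pi_matrix L \<theta>"
  have A: "A = vector [vector [S, - M], vector [- M, C]]"
    by (simp add: A_def Pi_matrix_def S_def C_def M_def)
  define l where "l = lambda_theta L c0 \<beta> \<theta> \<rho>"
  have l: "l = matrix_inv A *v vector [v1, v2]"
    by (simp add: l_def lambda_theta_def A_def v1_def v2_def)
  have "invertible A"
    using D unfolding A by (simp add: invertible_det_nz det_2 power2_eq_square)
  then have "A ** matrix_inv A = mat 1 \<and> matrix_inv A ** A = mat 1"
    unfolding invertible_def matrix_inv_def by (rule someI_ex)
  then have "A *v l = vector [v1, v2]"
    unfolding l by (simp add: matrix_vector_mul_assoc)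
  then have v: "v1 = S * l $ 1 - M * l $ 2" "v2 = - M * l $ 1 + C * l $ 2"
    unfolding A by (auto simp: vec_eq_iff forall_2 matrix_vector_mult_def sum_2)
  have "(S * C - M\<^sup>2) * l $ 1 = C * v1 + M * v2" "(S * C - M\<^sup>2) * l $ 2 = M * v1 + S * v2"
    unfolding v by (simp_all add: power2_eq_square algebra_simps)
  then show "lambda_theta L c0 \<beta> \<theta> \<rho> $ 1 = (C * v1 + M * v2) / (S * C - M\<^sup>2)"
    "lambda_theta L c0 \<beta> \<theta> \<rho> $ 2 = (M * v1 + S * v2) / (S * C - M\<^sup>2)"
    using D unfolding l_def[symmetric] by (simp_all add: field_simps)
  show "S * lambda_theta L c0 \<beta> \<theta> \<rho> $ 1 - M * lambda_theta L c0 \<beta> \<theta> \<rho> $ 2 = v1"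
    "- M * lambda_theta L c0 \<beta> \<theta> \<rho> $ 1 + C * lambda_theta L c0 \<beta> \<theta> \<rho> $ 2 = v2"
    unfolding l_def[symmetric] v by simp_all
qed

section \<open>The flow and its limit\<close>

locale flow =
  fixes L c0 \<mu> :: real and \<omega> :: int and \<beta> \<theta>0 \<rho>0 :: "real \<Rightarrow> real"
    and \<theta> \<rho> :: "real \<Rightarrow> real \<Rightarrow> real"
  assumes L_pos: "0 < L" and omega_nz: "\<omega> \<noteq> 0"
    and beta_deriv: "\<And>x. (\<beta> has_real_derivative deriv \<beta> x) (at x)"
    and beta_cont: "continuous_on UNIV (deriv \<beta>)"
    and flow: "flow_solution L \<omega> c0 \<beta> \<mu> \<theta>0 \<rho>0 \<theta> \<rho>"
begin

abbreviation \<kappa> :: "real \<Rightarrow> real \<Rightarrow> real" where "\<kappa> t \<equiv> ds L (\<theta> t)"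
abbreviation \<sigma> :: "real \<Rightarrow> real \<Rightarrow> real" where "\<sigma> t \<equiv> ds L (\<rho> t)"
abbreviation l1 :: "real \<Rightarrow> real" where "l1 t \<equiv> lambda_theta L c0 \<beta> (\<theta> t) (\<rho> t) $ 1"
abbreviation l2 :: "real \<Rightarrow> real" where "l2 t \<equiv> lambda_theta L c0 \<beta> (\<theta> t) (\<rho> t) $ 2"
abbreviation l3 :: "real \<Rightarrow> real" where "l3 t \<equiv> lambda_rho L c0 \<beta> (\<theta> t) (\<rho> t)"

text \<open>The bending moment and its \<open>s\<close>-derivative with the product rule carried
  out. In the form \<open>w1\<close> the right-hand side involves only derivatives up to second
  order, whose limits C^2 convergence provides.\<close>

definition w :: "real \<Rightarrow> real \<Rightarrow> real" where
  "w t s = \<beta> (\<rho> t s) * (\<kappa> t s - c0)"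
definition w1 :: "real \<Rightarrow> real \<Rightarrow> real" where
  "w1 t s = deriv \<beta> (\<rho> t s) * \<sigma> t s * (\<kappa> t s - c0) + \<beta> (\<rho> t s) * ds L (\<kappa> t) s"

lemma smooth: "smooth_spacetime L \<theta>" "smooth_spacetime L \<rho>"
    "smooth_spacetime L \<kappa>" "smooth_spacetime L \<sigma>"
    "smooth_spacetime L (dt \<theta>)" "smooth_spacetime L (dt \<rho>)"
    "smooth_spacetime L (dt \<kappa>)" "smooth_spacetime L (dt \<sigma>)"
    "smooth_spacetime L (\<lambda>t. ds L (\<kappa> t))" "smooth_spacetime L (\<lambda>t. ds L (\<sigma> t))"
proof -
  show *: "smooth_spacetime L \<theta>" "smooth_spacetime L \<rho>"
    using flow by (simp_all add: flow_solution_def)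
  show **: "smooth_spacetime L \<kappa>" "smooth_spacetime L \<sigma>"
    by (rule smooth_spacetime_ds, rule *)+
  show "smooth_spacetime L (dt \<theta>)" "smooth_spacetime L (dt \<rho>)"
    by (rule smooth_spacetime_dt, rule *)+
  show "smooth_spacetime L (dt \<kappa>)" "smooth_spacetime L (dt \<sigma>)"
    by (rule smooth_spacetime_dt, rule **)+
  show "smooth_spacetime L (\<lambda>t. ds L (\<kappa> t))" "smooth_spacetime L (\<lambda>t. ds L (\<sigma> t))"
    by (rule smooth_spacetime_ds, rule **)+
qed

lemmas slice_continuous [continuous_intros] = smooth[THEN smooth_spacetime_continuous_slice]
lemmas slice_derivs = smooth[THEN smooth_spacetime_derivs(2)]
lemmas time_derivs = smooth[THEN smooth_spacetime_derivs(1)]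

lemma beta_continuous: "continuous_on UNIV \<beta>"
  by (rule DERIV_continuous_on) (rule has_field_derivative_at_within[OF beta_deriv])

lemma beta_slice_continuous [continuous_intros]:
  assumes "0 < t"
  shows "continuous_on {0..L} (\<lambda>s. \<beta> (\<rho> t s))" "continuous_on {0..L} (\<lambda>s. deriv \<beta> (\<rho> t s))"
  by (rule continuous_on_compose2[OF beta_continuous slice_continuous(2)[OF assms]], simp)
     (rule continuous_on_compose2[OF beta_cont slice_continuous(2)[OF assms]], simp)

lemma ends:
  assumes "0 < t"
  shows "\<theta> t L - \<theta> t 0 = 2 * pi * of_int \<omega>" "\<rho> t L = \<rho> t 0" "\<kappa> t L = \<kappa> t 0" "\<sigma> t L = \<sigma> t 0"
  using flow assms by (simp_all add: flow_solution_def)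

lemma end_angle:
  assumes "0 < t"
  shows "sin (\<theta> t L) = sin (\<theta> t 0)" "cos (\<theta> t L) = cos (\<theta> t 0)"
proof -
  have "\<theta> t L = \<theta> t 0 + 2 * pi * of_int \<omega>" using ends(1)[OF assms] by simp
  then show "sin (\<theta> t L) = sin (\<theta> t 0)" "cos (\<theta> t L) = cos (\<theta> t 0)"
    by (simp_all add: sin_add cos_add sin_int_2pin cos_int_2pin)
qed

text \<open>The boundary conditions hold for all positive times and can be differentiated in time.
  The resulting periodicity of the velocities removes the boundary terms in the energy
  identity.\<close>

lemma end_velocities:
  assumes "0 < t"
  shows "dt \<theta> t L = dt \<theta> t 0" "dt \<rho> t L = dt \<rho> t 0"
proof -
  have L: "0 \<in> {0..L}" "L \<in> {0..L}" using L_pos by auto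
  have "((\<lambda>\<tau>. \<theta> \<tau> 0 + 2 * pi * of_int \<omega>) has_real_derivative dt \<theta> t 0) (at t)"
    using DERIV_add[OF time_derivs(1)[OF assms L(1)] DERIV_const[of "2 * pi * of_int \<omega>"]] by simp
  then have "((\<lambda>\<tau>. \<theta> \<tau> L) has_real_derivative dt \<theta> t 0) (at t)"
    by (rule has_field_derivative_transform_within_open[OF _ open_greaterThan[of 0]])
       (use assms ends(1) in \<open>auto simp: algebra_simps\<close>)
  then show "dt \<theta> t L = dt \<theta> t 0" by (rule dt_eq)
  have "((\<lambda>\<tau>. \<rho> \<tau> L) has_real_derivative dt \<rho> t 0) (at t)"
    by (rule has_field_derivative_transform_within_open[OF time_derivs(2)[OF assms L(1)] open_greaterThan[of 0]])
       (use assms ends(2) in auto)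
  then show "dt \<rho> t L = dt \<rho> t 0" by (rule dt_eq)
qed

lemma w_deriv:
  assumes "0 < t" "s \<in> {0..L}"
  shows "(w t has_real_derivative w1 t s) (at s within {0..L})"
proof -
  have "((\<lambda>s. \<beta> (\<rho> t s)) has_real_derivative deriv \<beta> (\<rho> t s) * \<sigma> t s) (at s within {0..L})"
    by (rule DERIV_chain2[OF beta_deriv slice_derivs(2)[OF assms]])
  from DERIV_mult[OF this DERIV_diff[OF slice_derivs(3)[OF assms] DERIV_const[of c0]]]
  show ?thesis by (simp add: w_def[abs_def] w1_def mult_ac)
qed

lemma w_continuous [continuous_intros]:
  assumes "0 < t"
  shows "continuous_on {0..L} (w t)" "continuous_on {0..L} (w1 t)"
  unfolding w_def[abs_def] w1_def[abs_def] by (intro continuous_intros assms)+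

lemma equations:
  assumes "0 < t" "s \<in> {0..L}"
  shows "dt \<theta> t s = w1 t s + l1 t * sin (\<theta> t s) - l2 t * cos (\<theta> t s)"
    and "dt \<rho> t s = \<mu> * ds L (\<sigma> t) s - 1 / 2 * deriv \<beta> (\<rho> t s) * (\<kappa> t s - c0)\<^sup>2 - l3 t"
proof -
  have "ds L (\<lambda>r. \<beta> (\<rho> t r) * (\<kappa> t r - c0)) s = w1 t s"
    using ds_eq[OF L_pos assms(2) w_deriv[OF assms]] by (simp add: w_def[abs_def])
  then show "dt \<theta> t s = w1 t s + l1 t * sin (\<theta> t s) - l2 t * cos (\<theta> t s)"
    "dt \<rho> t s = \<mu> * ds L (\<sigma> t) s - 1 / 2 * deriv \<beta> (\<rho> t s) * (\<kappa> t s - c0)\<^sup>2 - l3 t"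
    using flow assms by (simp_all add: flow_solution_def)
qed

section \<open>Explicit multipliers and orthogonality to the constraints\<close>

definition S :: "real \<Rightarrow> real" where "S t = integral {0..L} (\<lambda>s. (sin (\<theta> t s))\<^sup>2)"
definition C :: "real \<Rightarrow> real" where "C t = integral {0..L} (\<lambda>s. (cos (\<theta> t s))\<^sup>2)"
definition M :: "real \<Rightarrow> real" where "M t = integral {0..L} (\<lambda>s. cos (\<theta> t s) * sin (\<theta> t s))"
definition v1 :: "real \<Rightarrow> real" where
  "v1 t = integral {0..L} (\<lambda>s. cos (\<theta> t s) * \<kappa> t s * \<beta> (\<rho> t s) * (\<kappa> t s - c0))"
definition v2 :: "real \<Rightarrow> real" where
  "v2 t = integral {0..L} (\<lambda>s. sin (\<theta> t s) * \<kappa> t s * \<beta> (\<rho> t s) * (\<kappa> t s - c0))"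

lemma determinant_pos:
  assumes "0 < t"
  shows "0 < S t * C t - (M t)\<^sup>2"
  unfolding S_def C_def M_def
  by (rule Pi_determinant_pos[OF L_pos slice_continuous(1)[OF assms] ends(1)[OF assms] omega_nz])

lemma multipliers:
  assumes "0 < t"
  shows "l1 t = (C t * v1 t + M t * v2 t) / (S t * C t - (M t)\<^sup>2)"
    and "l2 t = (M t * v1 t + S t * v2 t) / (S t * C t - (M t)\<^sup>2)"
    and multiplier_system: "S t * l1 t - M t * l2 t = v1 t" "- M t * l1 t + C t * l2 t = v2 t"
  using lambda_theta_Cramer[of L "\<theta> t" c0 \<beta> "\<rho> t"] determinant_pos[OF assms]
  unfolding S_def C_def M_def v1_def v2_def by auto

text \<open>The multipliers are chosen for exactly this: \<open>cos \<theta>\<close>,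
  \<open>sin \<theta>\<close> and 1 represent, up to sign, the first variations of the closing
  conditions and the mass. Integrating by parts, \<open>w1 cos \<theta>\<close> and
  \<open>w1 sin \<theta>\<close> have integrals \<open>v2 t\<close> and \<open>- v1 t\<close>, which
  the linear system for \<open>l1\<close>, \<open>l2\<close> compensates; \<open>l3\<close>
  compensates the mean in the density equation.\<close>

lemma orthogonality:
  assumes t: "0 < t"
  shows "((\<lambda>s. cos (\<theta> t s) * dt \<theta> t s) has_integral 0) {0..L}"
    and "((\<lambda>s. sin (\<theta> t s) * dt \<theta> t s) has_integral 0) {0..L}"
    and "(dt \<rho> t has_integral 0) {0..L}"
proof -
  have SCM: "((\<lambda>s. (sin (\<theta> t s))\<^sup>2) has_integral S t) {0..L}"
    "((\<lambda>s. (cos (\<theta> t s))\<^sup>2) has_integral C t) {0..L}"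
    "((\<lambda>s. cos (\<theta> t s) * sin (\<theta> t s)) has_integral M t) {0..L}"
    "((\<lambda>s. cos (\<theta> t s) * \<kappa> t s * \<beta> (\<rho> t s) * (\<kappa> t s - c0)) has_integral v1 t) {0..L}"
    "((\<lambda>s. sin (\<theta> t s) * \<kappa> t s * \<beta> (\<rho> t s) * (\<kappa> t s - c0)) has_integral v2 t) {0..L}"
    unfolding S_def C_def M_def v1_def v2_def using t
    by (intro integrable_integral integrable_continuous_real continuous_intros; assumption)+
  have per: "w t L = w t 0" using ends[OF t] by (simp add: w_def)
  have "((\<lambda>s. w1 t s * cos (\<theta> t s) - sin (\<theta> t s) * \<kappa> t s * \<beta> (\<rho> t s) * (\<kappa> t s - c0)) has_integral
      w t L * cos (\<theta> t L) - w t 0 * cos (\<theta> t 0)) {0..L}"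
  proof (rule has_integral_real_derivative)
    fix s assume s: "s \<in> {0..L}"
    show "((\<lambda>s. w t s * cos (\<theta> t s)) has_real_derivative
        w1 t s * cos (\<theta> t s) - sin (\<theta> t s) * \<kappa> t s * \<beta> (\<rho> t s) * (\<kappa> t s - c0)) (at s within {0..L})"
      by (rule DERIV_cong[OF DERIV_mult[OF w_deriv[OF t s] DERIV_chain2[OF DERIV_cos slice_derivs(1)[OF t s]]]])
         (simp add: w_def algebra_simps)
  qed (use L_pos in auto)
  then have "((\<lambda>s. w1 t s * cos (\<theta> t s) - sin (\<theta> t s) * \<kappa> t s * \<beta> (\<rho> t s) * (\<kappa> t s - c0)) has_integral 0) {0..L}"
    by (simp add: per end_angle[OF t])
  from has_integral_diff[OF has_integral_add[OF has_integral_add[OF this SCM(5)] has_integral_mult_right[OF SCM(3), of "l1 t"]]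
      has_integral_mult_right[OF SCM(2), of "l2 t"]]
  show "((\<lambda>s. cos (\<theta> t s) * dt \<theta> t s) has_integral 0) {0..L}"
    using multiplier_system(2)[OF t]
    by (elim has_integral_eq_rhs[OF has_integral_eq[rotated]])
       (simp_all add: equations(1)[OF t] power2_eq_square algebra_simps)
  have "((\<lambda>s. w1 t s * sin (\<theta> t s) + cos (\<theta> t s) * \<kappa> t s * \<beta> (\<rho> t s) * (\<kappa> t s - c0)) has_integral
      w t L * sin (\<theta> t L) - w t 0 * sin (\<theta> t 0)) {0..L}"
  proof (rule has_integral_real_derivative)
    fix s assume s: "s \<in> {0..L}"
    show "((\<lambda>s. w t s * sin (\<theta> t s)) has_real_derivative
        w1 t s * sin (\<theta> t s) + cos (\<theta> t s) * \<kappa> t s * \<beta> (\<rho> t s) * (\<kappa> t s - c0)) (at s within {0..L})"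
      by (rule DERIV_cong[OF DERIV_mult[OF w_deriv[OF t s] DERIV_chain2[OF DERIV_sin slice_derivs(1)[OF t s]]]])
         (simp add: w_def algebra_simps)
  qed (use L_pos in auto)
  then have "((\<lambda>s. w1 t s * sin (\<theta> t s) + cos (\<theta> t s) * \<kappa> t s * \<beta> (\<rho> t s) * (\<kappa> t s - c0)) has_integral 0) {0..L}"
    by (simp add: per end_angle[OF t])
  from has_integral_diff[OF has_integral_add[OF has_integral_diff[OF this SCM(4)] has_integral_mult_right[OF SCM(1), of "l1 t"]]
      has_integral_mult_right[OF SCM(3), of "l2 t"]]
  show "((\<lambda>s. sin (\<theta> t s) * dt \<theta> t s) has_integral 0) {0..L}"
    using multiplier_system(1)[OF t]
    by (elim has_integral_eq_rhs[OF has_integral_eq[rotated]])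
       (simp_all add: equations(1)[OF t] power2_eq_square algebra_simps)
  let ?I = "integral {0..L} (\<lambda>s. deriv \<beta> (\<rho> t s) * (\<kappa> t s - c0)\<^sup>2)"
  have "(ds L (\<sigma> t) has_integral \<sigma> t L - \<sigma> t 0) {0..L}"
    using L_pos by (intro has_integral_real_derivative slice_derivs(4)[OF t]) auto
  then have "((\<lambda>s. \<mu> * ds L (\<sigma> t) s) has_integral \<mu> * 0) {0..L}"
    using ends[OF t] by (intro has_integral_mult_right) simp
  moreover have "((\<lambda>s. 1 / 2 * (deriv \<beta> (\<rho> t s) * (\<kappa> t s - c0)\<^sup>2)) has_integral 1 / 2 * ?I) {0..L}"
    using t by (intro has_integral_mult_right integrable_integral integrable_continuous_real continuous_intros)
  moreover have "((\<lambda>s. l3 t) has_integral l3 t * L) {0..L}"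
    using has_integral_const_real[of "l3 t" 0 L] L_pos by (simp add: mult.commute)
  ultimately have "((\<lambda>s. \<mu> * ds L (\<sigma> t) s - 1 / 2 * (deriv \<beta> (\<rho> t s) * (\<kappa> t s - c0)\<^sup>2) - l3 t) has_integral
      \<mu> * 0 - 1 / 2 * ?I - l3 t * L) {0..L}"
    by (intro has_integral_diff)
  then show "(dt \<rho> t has_integral 0) {0..L}"
    by (elim has_integral_eq_rhs[OF has_integral_eq[rotated]])
       (use L_pos in \<open>simp_all add: equations(2)[OF t] lambda_rho_def\<close>)
qed

section \<open>Dissipation of the energy and conservation of the constraints\<close>

definition energy :: "real \<Rightarrow> real" where
  "energy t = integral {0..L} (\<lambda>s. \<beta> (\<rho> t s) * (\<kappa> t s - c0)\<^sup>2 / 2 + \<mu> / 2 * (\<sigma> t s)\<^sup>2)"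

text \<open>The flow is the constrained L^2 gradient flow of the energy. After integration by parts
  the first variation is paired with the velocity, and the multiplier terms drop out because the
  velocity is orthogonal to the constraints.\<close>

lemma energy_deriv:
  assumes t: "0 < t"
  shows "(energy has_real_derivative
    - integral {0..L} (\<lambda>s. (dt \<theta> t s)\<^sup>2) - integral {0..L} (\<lambda>s. (dt \<rho> t s)\<^sup>2)) (at t)"
proof -
  define e' where "e' t s = deriv \<beta> (\<rho> t s) * dt \<rho> t s * (\<kappa> t s - c0)\<^sup>2 / 2
    + \<beta> (\<rho> t s) * (\<kappa> t s - c0) * dt \<kappa> t s + \<mu> * \<sigma> t s * dt \<sigma> t s" for t s :: real
  have "((\<lambda>\<tau>. integral {0..L} (\<lambda>s. \<beta> (\<rho> \<tau> s) * (\<kappa> \<tau> s - c0)\<^sup>2 / 2 + \<mu> / 2 * (\<sigma> \<tau> s)\<^sup>2))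
      has_real_derivative integral {0..L} (e' t)) (at t)"
  proof (rule leibniz_Icc)
    fix t s :: real assume ts: "0 < t" "s \<in> {0..L}"
    have "((\<lambda>\<tau>. \<beta> (\<rho> \<tau> s)) has_real_derivative deriv \<beta> (\<rho> t s) * dt \<rho> t s) (at t)"
      by (rule DERIV_chain2[OF beta_deriv time_derivs(2)[OF ts]])
    from DERIV_add[OF DERIV_cdivide[OF DERIV_mult[OF this
          DERIV_power[OF DERIV_diff[OF time_derivs(3)[OF ts] DERIV_const[of c0]], of 2]], of 2]
        DERIV_cmult[OF DERIV_power[OF time_derivs(4)[OF ts], of 2], of "\<mu> / 2"]]
    show "((\<lambda>\<tau>. \<beta> (\<rho> \<tau> s) * (\<kappa> \<tau> s - c0)\<^sup>2 / 2 + \<mu> / 2 * (\<sigma> \<tau> s)\<^sup>2) has_real_derivative e' t s) (at t)"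
      by (rule DERIV_cong) (simp add: e'_def field_simps)
  next
    fix t :: real assume "0 < t"
    then show "continuous_on {0..L} (\<lambda>s. \<beta> (\<rho> t s) * (\<kappa> t s - c0)\<^sup>2 / 2 + \<mu> / 2 * (\<sigma> t s)\<^sup>2)"
      by (intro continuous_intros) auto
  next
    let ?U = "{0::real<..} \<times> {0..L}"
    have c: "continuous_on ?U (\<lambda>p. u (fst p) (snd p))" if "smooth_spacetime L u" for u
      using smooth_spacetime_continuous[OF that] by (simp add: case_prod_beta')
    have "continuous_on ?U (\<lambda>p. \<beta> (\<rho> (fst p) (snd p)))" "continuous_on ?U (\<lambda>p. deriv \<beta> (\<rho> (fst p) (snd p)))"
      by (rule continuous_on_compose2[OF beta_continuous c[OF smooth(2)]], simp)
         (rule continuous_on_compose2[OF beta_cont c[OF smooth(2)]], simp)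
    then show "continuous_on ?U (\<lambda>(t, s). e' t s)"
      unfolding e'_def case_prod_beta' by (intro continuous_intros smooth[THEN c]) auto
  qed (rule t)
  moreover have "integral {0..L} (e' t) =
      - integral {0..L} (\<lambda>s. (dt \<theta> t s)\<^sup>2) - integral {0..L} (\<lambda>s. (dt \<rho> t s)\<^sup>2)"
  proof -
    \<comment> \<open>The total derivative of
      \<open>w dt \<theta> + \<mu> \<sigma> dt \<rho>\<close>, that is, both integrations by parts
      at once. Its integral vanishes since moment, slope and velocities are periodic.\<close>
    let ?b' = "\<lambda>s. w1 t s * dt \<theta> t s + w t s * dt \<kappa> t s + \<mu> * (ds L (\<sigma> t) s * dt \<rho> t s + \<sigma> t s * dt \<sigma> t s)"
    have "(?b' has_integral (w t L * dt \<theta> t L + \<mu> * (\<sigma> t L * dt \<rho> t L))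
        - (w t 0 * dt \<theta> t 0 + \<mu> * (\<sigma> t 0 * dt \<rho> t 0))) {0..L}"
    proof (rule has_integral_real_derivative)
      fix s assume s: "s \<in> {0..L}"
      have "(dt \<theta> t has_real_derivative dt \<kappa> t s) (at s within {0..L})"
        "(dt \<rho> t has_real_derivative dt \<sigma> t s) (at s within {0..L})"
        using slice_derivs(5,6)[OF t s] mixed_derivative[OF smooth(1) L_pos t s]
          mixed_derivative[OF smooth(2) L_pos t s] by simp_all
      from DERIV_add[OF DERIV_mult[OF w_deriv[OF t s] this(1)]
          DERIV_cmult[OF DERIV_mult[OF slice_derivs(4)[OF t s] this(2)], of \<mu>]]
      show "((\<lambda>s. w t s * dt \<theta> t s + \<mu> * (\<sigma> t s * dt \<rho> t s)) has_real_derivative ?b' s) (at s within {0..L})"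
        by (rule DERIV_cong) (simp add: algebra_simps)
    qed (use L_pos in auto)
    then have b': "(?b' has_integral 0) {0..L}"
      using ends[OF t] end_velocities[OF t] by (simp add: w_def)
    have sq: "((\<lambda>s. (dt \<theta> t s)\<^sup>2) has_integral integral {0..L} (\<lambda>s. (dt \<theta> t s)\<^sup>2)) {0..L}"
      "((\<lambda>s. (dt \<rho> t s)\<^sup>2) has_integral integral {0..L} (\<lambda>s. (dt \<rho> t s)\<^sup>2)) {0..L}"
      using t by (intro integrable_integral integrable_continuous_real continuous_intros; assumption)+
    note o = orthogonality[OF t]
    \<comment> \<open>Inserting the two equations for \<open>w1\<close> and
      \<open>\<mu> * ds L (\<sigma> t) s\<close> shows that \<open>e'\<close> is \<open>?b'\<close>
      minus the squared velocities plus multiples of the three integrands with integral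
      zero.\<close>
    have "((\<lambda>s. ?b' s + l1 t * (sin (\<theta> t s) * dt \<theta> t s) - l2 t * (cos (\<theta> t s) * dt \<theta> t s) - l3 t * dt \<rho> t s
        - (dt \<theta> t s)\<^sup>2 - (dt \<rho> t s)\<^sup>2) has_integral 0 + l1 t * 0 - l2 t * 0 - l3 t * 0
        - integral {0..L} (\<lambda>s. (dt \<theta> t s)\<^sup>2) - integral {0..L} (\<lambda>s. (dt \<rho> t s)\<^sup>2)) {0..L}"
      by (intro has_integral_diff has_integral_add has_integral_mult_right b' sq o)
    then have "(e' t has_integral - integral {0..L} (\<lambda>s. (dt \<theta> t s)\<^sup>2) - integral {0..L} (\<lambda>s. (dt \<rho> t s)\<^sup>2)) {0..L}"
    proof (elim has_integral_eq_rhs[OF has_integral_eq[rotated]])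
      fix s assume s: "s \<in> {0..L}"
      have w1: "w1 t s = dt \<theta> t s - l1 t * sin (\<theta> t s) + l2 t * cos (\<theta> t s)"
        and \<sigma>1: "\<mu> * ds L (\<sigma> t) s = dt \<rho> t s + 1 / 2 * deriv \<beta> (\<rho> t s) * (\<kappa> t s - c0)\<^sup>2 + l3 t"
        using equations[OF t s] by simp_all
      have b: "?b' s = (dt \<theta> t s - l1 t * sin (\<theta> t s) + l2 t * cos (\<theta> t s)) * dt \<theta> t s + w t s * dt \<kappa> t s
          + (dt \<rho> t s + 1 / 2 * deriv \<beta> (\<rho> t s) * (\<kappa> t s - c0)\<^sup>2 + l3 t) * dt \<rho> t s + \<mu> * \<sigma> t s * dt \<sigma> t s"
        unfolding w1[symmetric] \<sigma>1[symmetric] by (simp add: algebra_simps)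
      show "?b' s + l1 t * (sin (\<theta> t s) * dt \<theta> t s) - l2 t * (cos (\<theta> t s) * dt \<theta> t s) - l3 t * dt \<rho> t s
        - (dt \<theta> t s)\<^sup>2 - (dt \<rho> t s)\<^sup>2 = e' t s"
        unfolding b unfolding e'_def w_def power2_eq_square by (simp add: field_simps)
    qed simp
    then show ?thesis by (rule integral_unique)
  qed
  ultimately show ?thesis unfolding energy_def[abs_def] by simp
qed

lemma constraint_derivs:
  assumes t: "0 < t"
  shows "((\<lambda>t. integral {0..L} (\<lambda>s. sin (\<theta> t s))) has_real_derivative 0) (at t)"
    and "((\<lambda>t. integral {0..L} (\<lambda>s. cos (\<theta> t s))) has_real_derivative 0) (at t)"
    and "((\<lambda>t. integral {0..L} (\<rho> t)) has_real_derivative 0) (at t)"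
proof -
  let ?U = "{0::real<..} \<times> {0..L}"
  have c: "continuous_on ?U (\<lambda>p. u (fst p) (snd p))" if "smooth_spacetime L u" for u
    using smooth_spacetime_continuous[OF that] by (simp add: case_prod_beta')
  have "((\<lambda>\<tau>. integral {0..L} (\<lambda>s. sin (\<theta> \<tau> s))) has_real_derivative
      integral {0..L} (\<lambda>s. cos (\<theta> t s) * dt \<theta> t s)) (at t)"
  proof (rule leibniz_Icc)
    show "continuous_on ?U (\<lambda>(t, s). cos (\<theta> t s) * dt \<theta> t s)"
      unfolding case_prod_beta' by (intro continuous_intros smooth[THEN c])
    show "((\<lambda>\<tau>. sin (\<theta> \<tau> s)) has_real_derivative cos (\<theta> t s) * dt \<theta> t s) (at t)"
      if "0 < t" "s \<in> {0..L}" for t s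
      by (rule DERIV_chain2[OF DERIV_sin time_derivs(1)[OF that]])
    show "continuous_on {0..L} (\<lambda>s. sin (\<theta> t s))" if "0 < t" for t
      by (intro continuous_intros that)
  qed (rule t)
  then show "((\<lambda>t. integral {0..L} (\<lambda>s. sin (\<theta> t s))) has_real_derivative 0) (at t)"
    using orthogonality(1)[OF t] by (simp add: integral_unique)
  have "((\<lambda>\<tau>. integral {0..L} (\<lambda>s. cos (\<theta> \<tau> s))) has_real_derivative
      integral {0..L} (\<lambda>s. - sin (\<theta> t s) * dt \<theta> t s)) (at t)"
  proof (rule leibniz_Icc)
    show "continuous_on ?U (\<lambda>(t, s). - sin (\<theta> t s) * dt \<theta> t s)"
      unfolding case_prod_beta' by (intro continuous_intros smooth[THEN c])
    show "((\<lambda>\<tau>. cos (\<theta> \<tau> s)) has_real_derivative - sin (\<theta> t s) * dt \<theta> t s) (at t)"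
      if "0 < t" "s \<in> {0..L}" for t s
      by (rule DERIV_chain2[OF DERIV_cos time_derivs(1)[OF that]])
    show "continuous_on {0..L} (\<lambda>s. cos (\<theta> t s))" if "0 < t" for t
      by (intro continuous_intros that)
  qed (rule t)
  then show "((\<lambda>t. integral {0..L} (\<lambda>s. cos (\<theta> t s))) has_real_derivative 0) (at t)"
    using orthogonality(2)[OF t] by (simp add: integral_unique)
  have "((\<lambda>\<tau>. integral {0..L} (\<rho> \<tau>)) has_real_derivative integral {0..L} (dt \<rho> t)) (at t)"
    by (rule leibniz_Icc[OF time_derivs(2) slice_continuous(2) smooth_spacetime_continuous[OF smooth(6)] t])
  then show "((\<lambda>t. integral {0..L} (\<rho> t)) has_real_derivative 0) (at t)"
    using orthogonality(3)[OF t] by (simp add: integral_unique)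
qed

section \<open>Passage to the limit in time\<close>

lemma initial_limit:
  shows "C2_tendsto L \<theta> (\<theta> 0) (at 0 within {0..})" "C2_tendsto L \<rho> (\<rho> 0) (at 0 within {0..})"
  using flow by (auto simp: flow_solution_def continuous_into_C2_def)

lemma jet_integral_limits:
  fixes \<Phi> :: "(real \<times> real) \<times> real \<times> real \<Rightarrow> real"
  assumes "C2_tendsto L \<theta> \<theta>' at_top" "C2_tendsto L \<rho> \<rho>' at_top" "continuous_on UNIV \<Phi>"
  shows "((\<lambda>t. integral {0..L} (\<lambda>s. \<Phi> (jet L (\<theta> t) (\<rho> t) s))) \<longlongrightarrow>
      integral {0..L} (\<lambda>s. \<Phi> (jet L (\<theta> 0) (\<rho> 0) s))) (at_right 0)"
    and "((\<lambda>t. integral {0..L} (\<lambda>s. \<Phi> (jet L (\<theta> t) (\<rho> t) s))) \<longlongrightarrow>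
      integral {0..L} (\<lambda>s. \<Phi> (jet L \<theta>' \<rho>' s))) at_top"
  using jet_integral_tendsto[OF assms] jet_integral_tendsto[OF initial_limit assms(3)] L_pos
  by (auto intro: tendsto_within_subset)

lemma limit_energy_and_constraints:
  assumes lim: "C2_tendsto L \<theta> \<theta>' at_top" "C2_tendsto L \<rho> \<rho>' at_top"
  shows "integral {0..L} (\<lambda>s. sin (\<theta>' s)) = integral {0..L} (\<lambda>s. sin (\<theta> 0 s))"
    and "integral {0..L} (\<lambda>s. cos (\<theta>' s)) = integral {0..L} (\<lambda>s. cos (\<theta> 0 s))"
    and "integral {0..L} \<rho>' = integral {0..L} (\<rho> 0)"
    and "integral {0..L} (\<lambda>s. \<beta> (\<rho>' s) * (ds L \<theta>' s - c0)\<^sup>2 / 2 + \<mu> / 2 * (ds L \<rho>' s)\<^sup>2) \<le>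
      integral {0..L} (\<lambda>s. \<beta> (\<rho> 0 s) * (ds L (\<theta> 0) s - c0)\<^sup>2 / 2 + \<mu> / 2 * (ds L (\<rho> 0) s)\<^sup>2)"
proof -
  note J = jet_integral_limits[OF lim, unfolded jet_def]
  have bc: "continuous_on UNIV (\<lambda>p :: (real \<times> real) \<times> real \<times> real. \<beta> (fst (snd p)))"
    by (rule continuous_on_compose2[OF beta_continuous]) (auto intro!: continuous_intros)
  show "integral {0..L} (\<lambda>s. sin (\<theta>' s)) = integral {0..L} (\<lambda>s. sin (\<theta> 0 s))"
    using J[of "\<lambda>p. sin (fst (fst p))"]
    by (intro limits_of_constant[OF constraint_derivs(1)]) (auto simp: continuous_intros)
  show "integral {0..L} (\<lambda>s. cos (\<theta>' s)) = integral {0..L} (\<lambda>s. cos (\<theta> 0 s))"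
    using J[of "\<lambda>p. cos (fst (fst p))"]
    by (intro limits_of_constant[OF constraint_derivs(2)]) (auto simp: continuous_intros)
  show "integral {0..L} \<rho>' = integral {0..L} (\<rho> 0)"
    using J[of "\<lambda>p. fst (snd p)"]
    by (intro limits_of_constant[OF constraint_derivs(3)]) (auto simp: continuous_intros)
  show "integral {0..L} (\<lambda>s. \<beta> (\<rho>' s) * (ds L \<theta>' s - c0)\<^sup>2 / 2 + \<mu> / 2 * (ds L \<rho>' s)\<^sup>2) \<le>
      integral {0..L} (\<lambda>s. \<beta> (\<rho> 0 s) * (ds L (\<theta> 0) s - c0)\<^sup>2 / 2 + \<mu> / 2 * (ds L (\<rho> 0) s)\<^sup>2)"
  proof (rule limits_of_nonincreasing[OF energy_deriv])
    fix t :: real assume "0 < t"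
    then have "0 \<le> integral {0..L} (\<lambda>s. (dt \<theta> t s)\<^sup>2)" "0 \<le> integral {0..L} (\<lambda>s. (dt \<rho> t s)\<^sup>2)"
      by (auto intro!: integral_nonneg integrable_continuous_real continuous_intros)
    then show "- integral {0..L} (\<lambda>s. (dt \<theta> t s)\<^sup>2) - integral {0..L} (\<lambda>s. (dt \<rho> t s)\<^sup>2) \<le> 0" by linarith
  next
    let ?\<Phi> = "\<lambda>p :: (real \<times> real) \<times> real \<times> real. \<beta> (fst (snd p)) * (snd (fst p) - c0)\<^sup>2 / 2 + \<mu> / 2 * (snd (snd p))\<^sup>2"
    have "continuous_on UNIV ?\<Phi>" by (intro continuous_intros bc) auto
    from J[OF this]
    show "(energy \<longlongrightarrow> integral {0..L} (\<lambda>s. \<beta> (\<rho> 0 s) * (ds L (\<theta> 0) s - c0)\<^sup>2 / 2 + \<mu> / 2 * (ds L (\<rho> 0) s)\<^sup>2)) (at_right 0)"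
      "(energy \<longlongrightarrow> integral {0..L} (\<lambda>s. \<beta> (\<rho>' s) * (ds L \<theta>' s - c0)\<^sup>2 / 2 + \<mu> / 2 * (ds L \<rho>' s)\<^sup>2)) at_top"
      by (simp_all add: energy_def[abs_def])
  qed
qed

lemma limit_ends:
  assumes lim: "C2_tendsto L \<theta> \<theta>' at_top" "C2_tendsto L \<rho> \<rho>' at_top"
  shows "\<theta>' L - \<theta>' 0 = 2 * pi * of_int \<omega>" "ds L \<theta>' L = ds L \<theta>' 0" "\<rho>' L = \<rho>' 0" "ds L \<rho>' L = ds L \<rho>' 0"
proof -
  have L: "0 \<in> {0..L}" "L \<in> {0..L}" using L_pos by auto
  have eq: "a = b" if "(f \<longlongrightarrow> a) at_top" "(g \<longlongrightarrow> b) at_top" "\<And>t. 0 < t \<Longrightarrow> f t = g t"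
    for f g :: "real \<Rightarrow> real" and a b
  proof -
    have "\<forall>\<^sub>F t in at_top. f t = g t"
      using eventually_gt_at_top[of 0] by eventually_elim (rule that(3))
    with that(1) have "(g \<longlongrightarrow> a) at_top" by (rule Lim_transform_eventually)
    then show ?thesis using that(2) by (rule tendsto_unique[OF trivial_limit_at_top_linorder])
  qed
  note l = C2_tendsto_imp_tendsto[OF lim(1)] C2_tendsto_imp_tendsto[OF lim(2)]
  show "\<theta>' L - \<theta>' 0 = 2 * pi * of_int \<omega>"
    by (rule eq[OF tendsto_diff[OF l(1)[OF L(2)] l(1)[OF L(1)]] tendsto_const ends(1)])
  show "ds L \<theta>' L = ds L \<theta>' 0" by (rule eq[OF l(2)[OF L(2)] l(2)[OF L(1)] ends(3)])
  show "\<rho>' L = \<rho>' 0" by (rule eq[OF l(4)[OF L(2)] l(4)[OF L(1)] ends(2)])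
  show "ds L \<rho>' L = ds L \<rho>' 0" by (rule eq[OF l(5)[OF L(2)] l(5)[OF L(1)] ends(4)])
qed

text \<open>In the explicit quotients numerator and denominator converge. The limit of the
  denominator is nonzero because the limit angle inherits the winding condition, so its determinant
  is positive too.\<close>

lemma multipliers_converge:
  assumes lim: "C2_tendsto L \<theta> \<theta>' at_top" "C2_tendsto L \<rho> \<rho>' at_top"
  shows "\<exists>a. (l1 \<longlongrightarrow> a) at_top" "\<exists>a. (l2 \<longlongrightarrow> a) at_top" "\<exists>a. (l3 \<longlongrightarrow> a) at_top"
proof -
  note J = jet_integral_limits(2)[OF lim, unfolded jet_def]
  have bc: "continuous_on UNIV (\<lambda>p :: (real \<times> real) \<times> real \<times> real. \<beta> (fst (snd p)))"
    by (rule continuous_on_compose2[OF beta_continuous]) (auto intro!: continuous_intros)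
  have bc': "continuous_on UNIV (\<lambda>p :: (real \<times> real) \<times> real \<times> real. deriv \<beta> (fst (snd p)))"
    by (rule continuous_on_compose2[OF beta_cont]) (auto intro!: continuous_intros)
  define S' C' M' where "S' = integral {0..L} (\<lambda>s. (sin (\<theta>' s))\<^sup>2)"
    and "C' = integral {0..L} (\<lambda>s. (cos (\<theta>' s))\<^sup>2)" and "M' = integral {0..L} (\<lambda>s. cos (\<theta>' s) * sin (\<theta>' s))"
  have S: "(S \<longlongrightarrow> S') at_top"
    using J[of "\<lambda>p. (sin (fst (fst p)))\<^sup>2"] by (simp add: S_def[abs_def] S'_def continuous_intros)
  have C: "(C \<longlongrightarrow> C') at_top"
    using J[of "\<lambda>p. (cos (fst (fst p)))\<^sup>2"] by (simp add: C_def[abs_def] C'_def continuous_intros)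
  have M: "(M \<longlongrightarrow> M') at_top"
    using J[of "\<lambda>p. cos (fst (fst p)) * sin (fst (fst p))"] by (simp add: M_def[abs_def] M'_def continuous_intros)
  have c1: "continuous_on UNIV (\<lambda>p :: (real \<times> real) \<times> real \<times> real. cos (fst (fst p)) * snd (fst p) * \<beta> (fst (snd p)) * (snd (fst p) - c0))"
    and c2: "continuous_on UNIV (\<lambda>p :: (real \<times> real) \<times> real \<times> real. sin (fst (fst p)) * snd (fst p) * \<beta> (fst (snd p)) * (snd (fst p) - c0))"
    and c3: "continuous_on UNIV (\<lambda>p :: (real \<times> real) \<times> real \<times> real. deriv \<beta> (fst (snd p)) * (snd (fst p) - c0)\<^sup>2)"
    by (intro continuous_intros bc bc')+
  obtain v1' where v1: "(v1 \<longlongrightarrow> v1') at_top"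
    using J[OF c1] by (auto simp: v1_def[abs_def])
  obtain v2' where v2: "(v2 \<longlongrightarrow> v2') at_top"
    using J[OF c2] by (auto simp: v2_def[abs_def])
  have "continuous_on {0..L} \<theta>'"
    using lim(1) by (intro C2_on_interval_derivs) (simp add: C2_tendsto_def)
  then have D: "S' * C' - M'\<^sup>2 \<noteq> 0"
    using Pi_determinant_pos[OF L_pos _ limit_ends(1)[OF lim] omega_nz] by (auto simp: S'_def C'_def M'_def)
  have "((\<lambda>t. (C t * v1 t + M t * v2 t) / (S t * C t - (M t)\<^sup>2)) \<longlongrightarrow> (C' * v1' + M' * v2') / (S' * C' - M'\<^sup>2)) at_top"
    using D by (intro tendsto_intros S C M v1 v2)
  then have "(l1 \<longlongrightarrow> (C' * v1' + M' * v2') / (S' * C' - M'\<^sup>2)) at_top"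
    by (rule Lim_transform_eventually)
      (rule eventually_mono[OF eventually_gt_at_top[of 0] multipliers(1)[symmetric]])
  then show "\<exists>a. (l1 \<longlongrightarrow> a) at_top" by blast
  have "((\<lambda>t. (M t * v1 t + S t * v2 t) / (S t * C t - (M t)\<^sup>2)) \<longlongrightarrow> (M' * v1' + S' * v2') / (S' * C' - M'\<^sup>2)) at_top"
    using D by (intro tendsto_intros S C M v1 v2)
  then have "(l2 \<longlongrightarrow> (M' * v1' + S' * v2') / (S' * C' - M'\<^sup>2)) at_top"
    by (rule Lim_transform_eventually)
      (rule eventually_mono[OF eventually_gt_at_top[of 0] multipliers(2)[symmetric]])
  then show "\<exists>a. (l2 \<longlongrightarrow> a) at_top" by blast
  have "(l3 \<longlongrightarrow> - (1 / (2 * L)) * integral {0..L} (\<lambda>s. deriv \<beta> (\<rho>' s) * (ds L \<theta>' s - c0)\<^sup>2)) at_top"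
    unfolding lambda_rho_def using J[OF c3] by (intro tendsto_mult_left) simp
  then show "\<exists>a. (l3 \<longlongrightarrow> a) at_top" by blast
qed

text \<open>A velocity that converges along a convergent solution tends to zero.\<close>

lemma limit_stationary:
  assumes lim: "C2_tendsto L \<theta> \<theta>' at_top" "C2_tendsto L \<rho> \<rho>' at_top"
    and closed: "integral {0..L} (\<lambda>s. sin (\<theta> 0 s)) = 0" "integral {0..L} (\<lambda>s. cos (\<theta> 0 s)) = 0"
    and mass: "integral {0..L} (\<rho> 0) = \<nu> * L" and E: "energy 0 \<le> E"
  shows "\<exists>a b m. stationary_solution L c0 \<nu> E \<mu> a b m \<omega> \<beta> (deriv \<beta>)
    \<theta>' (ds L \<theta>') (ds L (ds L \<theta>')) \<rho>' (ds L \<rho>') (ds L (ds L \<rho>'))"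
proof -
  obtain a b m where abm: "(l1 \<longlongrightarrow> a) at_top" "(l2 \<longlongrightarrow> b) at_top" "(l3 \<longlongrightarrow> m) at_top"
    using multipliers_converge[OF lim] by blast
  have C2: "C2_on_interval L \<theta>'" "C2_on_interval L \<rho>'"
    using lim by (simp_all add: C2_tendsto_def)
  have stationary: "deriv \<beta> (\<rho>' s) * ds L \<rho>' s * (ds L \<theta>' s - c0) + \<beta> (\<rho>' s) * ds L (ds L \<theta>') s
        + a * sin (\<theta>' s) - b * cos (\<theta>' s) = 0"
      "\<mu> * ds L (ds L \<rho>') s - 1 / 2 * deriv \<beta> (\<rho>' s) * (ds L \<theta>' s - c0)\<^sup>2 - m = 0" if s: "s \<in> {0..L}" for s
  proof -
    note l\<theta> = C2_tendsto_imp_tendsto[OF lim(1) s] and l\<rho> = C2_tendsto_imp_tendsto[OF lim(2) s]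
    have vel: "((\<lambda>\<tau>. \<theta> \<tau> s) has_real_derivative dt \<theta> t s) (at t)"
      "((\<lambda>\<tau>. \<rho> \<tau> s) has_real_derivative dt \<rho> t s) (at t)" if "0 < t" for t
      by (rule time_derivs(1,2)[OF that s])+
    have "isCont \<beta> (\<rho>' s)" by (rule DERIV_isCont[OF beta_deriv])
    then have l\<beta>: "((\<lambda>t. \<beta> (\<rho> t s)) \<longlongrightarrow> \<beta> (\<rho>' s)) at_top"
      by (rule isCont_tendsto_compose) (rule l\<rho>(1))
    have "isCont (deriv \<beta>) (\<rho>' s)"
      using beta_cont by (simp add: continuous_on_eq_continuous_at)
    then have l\<beta>': "((\<lambda>t. deriv \<beta> (\<rho> t s)) \<longlongrightarrow> deriv \<beta> (\<rho>' s)) at_top"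
      by (rule isCont_tendsto_compose) (rule l\<rho>(1))
    have ev: "\<forall>\<^sub>F t in at_top. (0::real) < t" by (rule eventually_gt_at_top)
    \<comment> \<open>At fixed \<open>s\<close>, C^2 convergence and the convergent multipliers give
      a limit for every term of the right-hand side. So the velocity has a limit, and this limit
      must be 0 because the angle itself converges.\<close>
    have "((\<lambda>t. w1 t s + l1 t * sin (\<theta> t s) - l2 t * cos (\<theta> t s)) \<longlongrightarrow>
        deriv \<beta> (\<rho>' s) * ds L \<rho>' s * (ds L \<theta>' s - c0) + \<beta> (\<rho>' s) * ds L (ds L \<theta>') s
        + a * sin (\<theta>' s) - b * cos (\<theta>' s)) at_top"
      unfolding w1_def by (intro tendsto_intros l\<theta> l\<rho> l\<beta> l\<beta>' abm)
    then have "((\<lambda>t. dt \<theta> t s) \<longlongrightarrow> deriv \<beta> (\<rho>' s) * ds L \<rho>' s * (ds L \<theta>' s - c0) + \<beta> (\<rho>' s) * ds L (ds L \<theta>') s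
        + a * sin (\<theta>' s) - b * cos (\<theta>' s)) at_top"
      by (rule Lim_transform_eventually) (rule eventually_mono[OF ev equations(1)[OF _ s, symmetric]])
    then show "deriv \<beta> (\<rho>' s) * ds L \<rho>' s * (ds L \<theta>' s - c0) + \<beta> (\<rho>' s) * ds L (ds L \<theta>') s
        + a * sin (\<theta>' s) - b * cos (\<theta>' s) = 0"
      by (intro limit_of_derivative_zero[where f = "\<lambda>t. \<theta> t s" and f' = "\<lambda>t. dt \<theta> t s", OF _ l\<theta>(1)] vel)
    have "((\<lambda>t. \<mu> * ds L (\<sigma> t) s - 1 / 2 * deriv \<beta> (\<rho> t s) * (\<kappa> t s - c0)\<^sup>2 - l3 t) \<longlongrightarrow>
        \<mu> * ds L (ds L \<rho>') s - 1 / 2 * deriv \<beta> (\<rho>' s) * (ds L \<theta>' s - c0)\<^sup>2 - m) at_top"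
      by (intro tendsto_intros l\<theta> l\<rho> l\<beta> l\<beta>' abm)
    then have "((\<lambda>t. dt \<rho> t s) \<longlongrightarrow>
        \<mu> * ds L (ds L \<rho>') s - 1 / 2 * deriv \<beta> (\<rho>' s) * (ds L \<theta>' s - c0)\<^sup>2 - m) at_top"
      by (rule Lim_transform_eventually) (rule eventually_mono[OF ev equations(2)[OF _ s, symmetric]])
    then show "\<mu> * ds L (ds L \<rho>') s - 1 / 2 * deriv \<beta> (\<rho>' s) * (ds L \<theta>' s - c0)\<^sup>2 - m = 0"
      by (intro limit_of_derivative_zero[where f = "\<lambda>t. \<rho> t s" and f' = "\<lambda>t. dt \<rho> t s", OF _ l\<rho>(1)] vel)
  qed
  have "stationary_solution L c0 \<nu> E \<mu> a b m \<omega> \<beta> (deriv \<beta>)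
    \<theta>' (ds L \<theta>') (ds L (ds L \<theta>')) \<rho>' (ds L \<rho>') (ds L (ds L \<rho>'))"
  proof
    fix s assume s: "s \<in> {0..L}"
    show "\<beta> (\<rho>' s) * ds L (ds L \<theta>') s + deriv \<beta> (\<rho>' s) * ds L \<rho>' s * (ds L \<theta>' s - c0) =
        - a * sin (\<theta>' s) + b * cos (\<theta>' s)"
      using stationary(1)[OF s] by linarith
    show "\<mu> * ds L (ds L \<rho>') s = deriv \<beta> (\<rho>' s) * (ds L \<theta>' s - c0)\<^sup>2 / 2 + m"
      using stationary(2)[OF s] by simp
  next
    show "integral {0..L} (\<lambda>s. \<beta> (\<rho>' s) * (ds L \<theta>' s - c0)\<^sup>2 / 2 + \<mu> / 2 * (ds L \<rho>' s)\<^sup>2) \<le> E"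
      using limit_energy_and_constraints(4)[OF lim] E by (simp add: energy_def)
  qed (use C2_on_interval_derivs(1,2)[OF C2(1)] C2_on_interval_derivs(1,2)[OF C2(2)] limit_ends[OF lim]
      limit_energy_and_constraints(1-3)[OF lim] closed mass in simp_all)
  then show ?thesis by blast
qed

end

section \<open>Rigidity applied to the limit of the flow\<close>

lemma smooth_on_R_deriv:
  assumes "smooth_on_R f"
  shows "((deriv ^^ n) f has_real_derivative deriv ((deriv ^^ n) f) x) (at x)"
proof -
  have "(deriv ^^ n) f differentiable (at x)" using assms by (simp add: smooth_on_R_def)
  then show ?thesis
    by (simp add: DERIV_deriv_iff_real_differentiable)
qed

theorem theorem1p6:
  fixes L \<nu> c0 :: real and \<omega> :: int
    and \<beta> \<theta>0 \<rho>0 :: "real \<Rightarrow> real"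
  assumes "L > 0"
    and "smooth_on_R \<beta>" and "\<forall>x. \<beta> x > 0"
    and "\<omega> \<noteq> 0"
    and "real_analytic \<beta>"
    and "admissible_datum L \<nu> \<omega> \<theta>0 \<rho>0"
    and "\<forall>s\<in>{0..L}. \<rho>0 s = \<nu>"
  shows "\<exists>\<mu>0>0. \<forall>\<mu>\<ge>\<mu>0. \<forall>\<theta> \<rho> \<theta>lim \<rho>lim.
           flow_solution L \<omega> c0 \<beta> \<mu> \<theta>0 \<rho>0 \<theta> \<rho> \<and>
           C2_tendsto L \<theta> \<theta>lim at_top \<and> C2_tendsto L \<rho> \<rho>lim at_top \<longrightarrow>
           (\<forall>s\<in>{0..L}. ds L \<theta>lim s = 2 * pi * of_int \<omega> / L \<and> \<rho>lim s = \<nu>)"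
proof -
  have \<beta>1: "(\<beta> has_real_derivative deriv \<beta> x) (at x)" for x
    using smooth_on_R_deriv[OF assms(2), of 0] by simp
  have \<beta>2: "(deriv \<beta> has_real_derivative deriv (deriv \<beta>) x) (at x)" for x
    using smooth_on_R_deriv[OF assms(2), of 1] by simp
  have \<beta>3: "(deriv (deriv \<beta>) has_real_derivative deriv (deriv (deriv \<beta>)) x) (at x)" for x
    using smooth_on_R_deriv[OF assms(2), of 2] by (simp add: numeral_2_eq_2)
  have cont: "continuous_on UNIV (deriv \<beta>)" "continuous_on UNIV (deriv (deriv \<beta>))"
    by (rule DERIV_continuous_on, rule has_field_derivative_at_within, rule \<beta>2 \<beta>3)+
  have pos: "\<beta> x > 0" for x using assms(3) by simp
  \<comment> \<open>The initial energy. The constant density has no gradient term, hence \<mu> does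
    not occur and the threshold can be chosen from \<open>E\<close>.\<close>
  define E where "E = integral {0..L} (\<lambda>s. \<beta> \<nu> * (ds L \<theta>0 s - c0)\<^sup>2 / 2)"
  obtain \<mu>0 where "\<mu>0 > 0" and \<mu>0: "\<forall>\<mu>\<ge>\<mu>0. \<forall>l1 l2 m \<theta> \<kappa> \<kappa>1 \<rho> \<sigma> \<sigma>1.
    stationary_solution L c0 \<nu> E \<mu> l1 l2 m \<omega> \<beta> (deriv \<beta>) \<theta> \<kappa> \<kappa>1 \<rho> \<sigma> \<sigma>1 \<longrightarrow>
    (\<forall>s\<in>{0..L}. \<kappa> s = 2 * pi * of_int \<omega> / L \<and> \<rho> s = \<nu>)"
    using stationary_rigidity[OF assms(1,4) \<beta>1 \<beta>2 cont(2) pos, of c0 \<nu> E] by (elim exE conjE)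
  show ?thesis
  proof (intro exI[of _ \<mu>0] conjI allI impI)
    fix \<mu> \<theta> \<rho> \<theta>lim \<rho>lim
    assume "\<mu>0 \<le> \<mu>" and *: "flow_solution L \<omega> c0 \<beta> \<mu> \<theta>0 \<rho>0 \<theta> \<rho> \<and>
      C2_tendsto L \<theta> \<theta>lim at_top \<and> C2_tendsto L \<rho> \<rho>lim at_top"
    interpret flow L c0 \<mu> \<omega> \<beta> \<theta>0 \<rho>0 \<theta> \<rho>
      by unfold_locales (use assms * \<beta>1 cont in auto)
    have init: "\<theta> 0 s = \<theta>0 s" "\<rho> 0 s = \<nu>" if "s \<in> {0..L}" for s
      using * assms(7) that by (auto simp: flow_solution_def)
    \<comment> \<open>The initial condition identifies the functions only on \<open>{0..L}\<close>;
      derivatives within that interval depend on nothing else, which is what allows the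
      transfer.\<close>
    have dsinit: "ds L (\<theta> 0) s = ds L \<theta>0 s" "ds L (\<rho> 0) s = 0" if s: "s \<in> {0..L}" for s
    proof -
      have "smooth_on_interval L \<theta>0" using assms(6) by (simp add: admissible_datum_def)
      then have "\<theta>0 differentiable (at s within {0..L})"
        using s unfolding smooth_on_interval_def by (metis funpow_0)
      from differentiable_imp_ds[OF this]
      have "(\<theta> 0 has_real_derivative ds L \<theta>0 s) (at s within {0..L})"
        by (rule has_field_derivative_transform_within[OF _ zero_less_one s]) (simp add: init)
      then show "ds L (\<theta> 0) s = ds L \<theta>0 s" by (rule ds_eq[OF assms(1) s])
      have "(\<rho> 0 has_real_derivative 0) (at s within {0..L})"
        by (rule has_field_derivative_transform_within[OF DERIV_const[of \<nu>] zero_less_one s]) (simp add: init)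
      then show "ds L (\<rho> 0) s = 0" by (rule ds_eq[OF assms(1) s])
    qed
    have "energy 0 = E"
      unfolding energy_def E_def by (intro integral_cong) (simp add: init dsinit)
    moreover have "integral {0..L} (\<lambda>s. sin (\<theta> 0 s)) = integral {0..L} (\<lambda>s. sin (\<theta>0 s))"
      "integral {0..L} (\<lambda>s. cos (\<theta> 0 s)) = integral {0..L} (\<lambda>s. cos (\<theta>0 s))"
      by (intro integral_cong; simp add: init)+
    moreover have "integral {0..L} (\<rho> 0) = integral {0..L} (\<lambda>s. \<nu>)"
      by (intro integral_cong) (simp add: init)
    ultimately obtain a b m where "stationary_solution L c0 \<nu> E \<mu> a b m \<omega> \<beta> (deriv \<beta>)
        \<theta>lim (ds L \<theta>lim) (ds L (ds L \<theta>lim)) \<rho>lim (ds L \<rho>lim) (ds L (ds L \<rho>lim))"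
      using limit_stationary[of \<theta>lim \<rho>lim \<nu> E] * assms(1,6) by (auto simp: admissible_datum_def)
    then show "\<forall>s\<in>{0..L}. ds L \<theta>lim s = 2 * pi * of_int \<omega> / L \<and> \<rho>lim s = \<nu>"
      using \<mu>0[rule_format, OF \<open>\<mu>0 \<le> \<mu>\<close>] by blast
  qed (rule \<open>\<mu>0 > 0\<close>)
qed

end
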